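(* Let $n,m\in\mathbb{N}$ and let $\varrho:\mathbb{C}\to\mathbb{C}$ be a continuous function which is real differentiable at some point $z_0\in\mathbb{C}$ with non-vanishing derivative there, i.e. $\left(\frac{\partial\varrho}{\partial x}(z_0),\frac{\partial\varrho}{\partial y}(z_0)\right)\neq(0,0)$. Then $\mathcal{NN}^\varrho_{n,m,2n+2m+5}$ is universal if and only if $\varrho$ is neither holomorphic, nor antiholomorphic, nor $\mathbb{R}$-affine.
   Context: For $\varrho:\mathbb{C}\to\mathbb{C}$ and $n,m,W\in\mathbb{N}$, $\mathcal{NN}^\varrho_{n,m,W}$ denotes the set of all functions $\mathbb{C}^n\to\mathbb{C}^m$ of the form $V_L\circ\varrho^{\times W}\circ V_{L-1}\circ\cdots\circ\varrho^{\times W}\circ V_1$ with arbitrary depth $L\ge 2$, where $V_1:\mathbb{C}^n\to\mathbb{C}^W$, $V_2,\dots,V_{L-1}:\mathbb{C}^W\to\mathbb{C}^W$, $V_L:\mathbb{C}^W\to\mathbb{C}^m$ are $\mathbb{C}$-affine maps (of the form $z\mapsto Az+b$ with complex matrix $A$ and complex vector $b$) and $\varrho^{\times W}(z_1,\dots,z_W)=(\varrho(z_1),\dots,\varrho(z_W))$. A class $\mathcal{F}\subseteq C(\mathbb{C}^n;\mathbb{C}^m)$ is called universal if for every $g\in C(\mathbb{C}^n;\mathbb{C}^m)$, every compact $K\subseteq\mathbb{C}^n$ and every $\varepsilon>0$ there is $f\in\mathcal{F}$ with $\sup_{z\in K}\|f(z)-g(z)\|<\varepsilon$ (Euclidean norm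 on $\mathbb{C}^m$). $\varrho$ is real differentiable at $z_0$ if the partial derivatives $\frac{\partial\varrho}{\partial x}(z_0),\frac{\partial\varrho}{\partial y}(z_0)$ (with respect to real and imaginary part) exist and $\lim_{h\to0}\frac{\varrho(z_0+h)-\varrho(z_0)-\frac{\partial\varrho}{\partial x}(z_0)\mathrm{Re}(h)-\frac{\partial\varrho}{\partial y}(z_0)\mathrm{Im}(h)}{h}=0$. $\varrho$ is antiholomorphic if $\overline{\varrho}$ is holomorphic. $\varrho$ is $\mathbb{R}$-affine if it is affine as a map $\mathbb{R}^2\to\mathbb{R}^2$ (identifying $\mathbb{C}\cong\mathbb{R}^2$). *)

theory Defs
  imports "HOL-Complex_Analysis.Complex_Analysis"
begin

text \<open>Points of C^n are vectors of type complex^'n (so n = CARD('n) >= 1, Euclidean norm).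
  Hidden layers of width W are represented as functions nat => complex, only the
  coordinates i < W being relevant (others are kept 0).\<close>

definition input_layer :: "nat \<Rightarrow> (nat \<Rightarrow> 'n::finite \<Rightarrow> complex) \<Rightarrow> (nat \<Rightarrow> complex)
    \<Rightarrow> complex^'n \<Rightarrow> (nat \<Rightarrow> complex)" where
  "input_layer W A b z = (\<lambda>i. if i < W then (\<Sum>j\<in>UNIV. A i j * z $ j) + b i else 0)"

definition hidden_layer :: "nat \<Rightarrow> (nat \<Rightarrow> nat \<Rightarrow> complex) \<Rightarrow> (nat \<Rightarrow> complex)
    \<Rightarrow> (nat \<Rightarrow> complex) \<Rightarrow> (nat \<Rightarrow> complex)" where
  "hidden_layer W A b z = (\<lambda>i. if i < W then (\<Sum>j<W. A i j * z j) + b i else 0)"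

definition output_layer :: "nat \<Rightarrow> ('m::finite \<Rightarrow> nat \<Rightarrow> complex) \<Rightarrow> complex^'m
    \<Rightarrow> (nat \<Rightarrow> complex) \<Rightarrow> complex^'m" where
  "output_layer W A b z = (\<chi> k. (\<Sum>j<W. A k j * z j) + b $ k)"

definition activ :: "nat \<Rightarrow> (complex \<Rightarrow> complex) \<Rightarrow> (nat \<Rightarrow> complex) \<Rightarrow> (nat \<Rightarrow> complex)" where
  "activ W \<rho> z = (\<lambda>i. if i < W then \<rho> (z i) else 0)"

inductive_set hidden_part :: "(complex \<Rightarrow> complex) \<Rightarrow> nat \<Rightarrow> (complex^'n::finite \<Rightarrow> (nat \<Rightarrow> complex)) set"
  for \<rho> W where
  first: "activ W \<rho> \<circ> input_layer W A b \<in> hidden_part \<rho> W"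
| step: "f \<in> hidden_part \<rho> W \<Longrightarrow> activ W \<rho> \<circ> hidden_layer W A b \<circ> f \<in> hidden_part \<rho> W"

definition NN :: "(complex \<Rightarrow> complex) \<Rightarrow> nat \<Rightarrow> (complex^'n::finite \<Rightarrow> complex^'m::finite) set" where
  "NN \<rho> W = {output_layer W A b \<circ> f | A b f. f \<in> hidden_part \<rho> W}"

definition universal :: "(complex^'n::finite \<Rightarrow> complex^'m::finite) set \<Rightarrow> bool" where
  "universal F \<longleftrightarrow> (\<forall>g K \<epsilon>. continuous_on UNIV g \<longrightarrow> compact K \<longrightarrow> \<epsilon> > 0 \<longrightarrow>
     (\<exists>f\<in>F. \<forall>z\<in>K. norm (f z - g z) < \<epsilon>))"

definition real_diff_at :: "(complex \<Rightarrow> complex) \<Rightarrow> complex \<Rightarrow> complex \<Rightarrow> complex \<Rightarrow> bool" where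
  "real_diff_at \<rho> z0 px py \<longleftrightarrow>
     ((\<lambda>t::real. \<rho> (z0 + of_real t)) has_vector_derivative px) (at 0) \<and>
     ((\<lambda>t::real. \<rho> (z0 + \<i> * of_real t)) has_vector_derivative py) (at 0) \<and>
     ((\<lambda>h. (\<rho> (z0 + h) - \<rho> z0 - px * of_real (Re h) - py * of_real (Im h)) / h) \<longlongrightarrow> 0) (at 0)"

definition antiholomorphic :: "(complex \<Rightarrow> complex) \<Rightarrow> bool" where
  "antiholomorphic \<rho> \<longleftrightarrow> (\<lambda>z. cnj (\<rho> z)) holomorphic_on UNIV"

definition R_affine :: "(complex \<Rightarrow> complex) \<Rightarrow> bool" where
  "R_affine \<rho> \<longleftrightarrow> (\<exists>L c. linear L \<and> (\<forall>z. \<rho> z = L z + c))"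

end

theory Submission
  imports Defs
begin

text \<open>
  Necessity: along a complex line a network is entire, conjugate to an entire function, or
  \<open>\<real>\<close>-affine. None of these is close to \<open>t \<mapsto> \<bar>t\<bar>\<close> on the unit disc, by the maximum principle,
  respectively by comparing the values at \<open>-1, 0, 1\<close>.

  Sufficiency: since the derivative at \<open>z0\<close> does not vanish, two neurons per layer transport a
  complex number \<open>w\<close> (or always its conjugate) approximately unchanged. With \<open>n + m + 2\<close> such
  registers and one more neuron per layer, a network can keep its input, accumulate its output, and
  evaluate, one term at a time, any finite linear combination of \<open>w \<mapsto> \<sigma> (a w + b)\<close> at an affine
  functional of the input; here \<open>\<sigma>\<close> is \<open>\<rho>\<close> or \<open>\<rho> \<circ> cnj\<close>. The closed span of these
  functions contains iterated integral means of \<open>\<sigma>\<close>, hence their derivatives, hence \<open>w\<close> and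
  \<open>cnj w\<close> (so \<open>Re\<close>), and a function that restricts to \<open>x\<^sup>2\<close> on the real line. Repeated squaring gives
  \<open>exp \<circ> Re\<close> as the limit of \<open>(1 + Re w / 2^k)^(2^k)\<close>, and the linear combinations of
  \<open>exp (Re (\<Sum>j. a j * z j))\<close> are dense by the Stone--Weierstrass theorem.
\<close>

text \<open>The width is 2 (n + m + 2) + 1: besides the n input and m output registers there are two
  scratch registers, for an argument and a partial sum. At fixed width, networks cannot be placed
  side by side, so sums are built up serially in a register; only the depth is unlimited.
  Approximation by ridge functions alone cannot suffice: if \<sigma> is a polynomial in z and cnj z,
  their closed span contains only polynomials of bounded degree. Hence the span serves only for two
  elementary functions, the real part and a real square, and everything else comes from composition.
  Exponentials are the target because products add exponents, so no product of two registers is ever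
  computed. Taking the real part first confines squaring to real arguments, which avoids
  distinguishing the quadratic forms (\<open>w\<^sup>2\<close>, \<open>w * cnj w\<close>, ...) that
  \<sigma> may yield.\<close>

unbundle no fps_syntax

section \<open>Necessity\<close>

lemma norm_axis_complex: "norm (axis k t :: complex^'n::finite) = norm t"
  by (simp add: norm_vec_def L2_set_def axis_def if_distrib[of "\<lambda>x. (norm x)\<^sup>2"] cong: if_cong)

lemma input_layer_axis:
  "input_layer W A b (axis k t) = (\<lambda>i. if i < W then A i k * t + b i else 0)"
  by (auto simp: input_layer_def axis_def fun_eq_iff if_distrib cong: if_cong)

lemma hidden_part_holomorphic:
  assumes \<rho>: "\<rho> holomorphic_on UNIV" and f: "f \<in> hidden_part \<rho> W"
  shows "(\<lambda>t. f (axis k t) i) holomorphic_on UNIV"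
proof -
  have comp: "(\<lambda>t. \<rho> (g t)) holomorphic_on UNIV" if "g holomorphic_on UNIV" for g
    using holomorphic_on_compose_gen[OF that \<rho>] by (simp add: o_def)
  from f show ?thesis
  proof (induction arbitrary: i)
    case (first A b)
    then show ?case
      by (cases "i < W") (auto simp: activ_def input_layer_axis intro!: comp holomorphic_intros)
  next
    case (step f A b)
    then show ?case
      by (cases "i < W") (auto simp: activ_def hidden_layer_def intro!: comp holomorphic_intros)
  qed
qed

text \<open>Each layer conjugates once, so the kind of dependence alternates with depth. The
  alternative concerns all coordinates together: a mixture of both kinds would not survive the next
  affine map.\<close>

lemma hidden_part_antiholomorphic:
  assumes \<rho>: "antiholomorphic \<rho>" and f: "f \<in> hidden_part \<rho> W"
  shows "(\<forall>i. (\<lambda>t. f (axis k t) i) holomorphic_on UNIV) \<or>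
         (\<forall>i. (\<lambda>t. cnj (f (axis k t) i)) holomorphic_on UNIV)"
proof -
  have hol: "(\<lambda>z. cnj (\<rho> z)) holomorphic_on UNIV" using \<rho> by (simp add: antiholomorphic_def)
  have comp: "(\<lambda>t. cnj (\<rho> (g t))) holomorphic_on UNIV" if "g holomorphic_on UNIV" for g
    using holomorphic_on_compose_gen[OF that hol] by (simp add: o_def)
  \<comment> \<open>\<open>\<rho> (cnj z)\<close> is \<open>cnj (h (cnj z))\<close> for the entire
    function \<open>h z = cnj (\<rho> z)\<close>: Schwarz reflection.\<close>
  have hol': "(\<lambda>z. \<rho> (cnj z)) holomorphic_on UNIV"
    using holomorphic_on_compose_cnj_cnj[of "\<lambda>z. cnj (\<rho> z)" UNIV] hol
    by (simp add: o_def holomorphic_on_subset)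
  have comp': "(\<lambda>t. \<rho> (g t)) holomorphic_on UNIV"
    if "(\<lambda>t. cnj (g t)) holomorphic_on UNIV" for g :: "complex \<Rightarrow> complex"
    using holomorphic_on_compose_gen[OF that hol'] by (simp add: o_def)
  from f show ?thesis
  proof induction
    case (first A b)
    have "(\<lambda>t. cnj ((activ W \<rho> \<circ> input_layer W A b) (axis k t) i)) holomorphic_on UNIV" for i
      by (cases "i < W") (auto simp: activ_def input_layer_axis intro!: comp holomorphic_intros)
    then show ?case by blast
  next
    case (step f A b)
    from step.IH show ?case
    proof
      assume "\<forall>i. (\<lambda>t. f (axis k t) i) holomorphic_on UNIV"
      then have "(\<lambda>t. cnj ((activ W \<rho> \<circ> hidden_layer W A b \<circ> f) (axis k t) i)) holomorphic_on UNIV" for i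
        by (cases "i < W") (auto simp: activ_def hidden_layer_def intro!: comp holomorphic_intros)
      then show ?case by blast
    next
      assume "\<forall>i. (\<lambda>t. cnj (f (axis k t) i)) holomorphic_on UNIV"
      then have "(\<lambda>t. (\<Sum>j<W. cnj (A i j) * cnj (f (axis k t) j)) + cnj (b i)) holomorphic_on UNIV" for i
        by (intro holomorphic_intros) auto
      then have "(\<lambda>t. cnj ((\<Sum>j<W. A i j * f (axis k t) j) + b i)) holomorphic_on UNIV" for i
        by simp
      from comp'[OF this]
      have "(\<lambda>t. (activ W \<rho> \<circ> hidden_layer W A b \<circ> f) (axis k t) i) holomorphic_on UNIV" for i
        by (cases "i < W") (auto simp: activ_def hidden_layer_def)
      then show ?case by blast
    qed
  qed
qed

text \<open>Only preservation of midpoints is carried through the layers: complex-affine maps and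
  \<rho> both have it, and 0 is the midpoint of 1 and -1.\<close>

lemma hidden_part_R_affine:
  assumes \<rho>: "R_affine \<rho>" and f: "f \<in> hidden_part \<rho> W"
  shows "f (axis k 1) i + f (axis k (-1)) i = 2 * f (axis k 0) i"
proof -
  obtain L c where L: "linear L" and \<rho>_eq: "\<And>z. \<rho> z = L z + c"
    using \<rho> by (auto simp: R_affine_def)
  have mid: "\<rho> x + \<rho> y = 2 * \<rho> z" if "x + y = 2 * z" for x y z
  proof -
    have "L x + L y = L (z + z)"
      using that by (simp flip: linear_add[OF L] mult_2)
    also have "\<dots> = 2 * L z" by (simp only: linear_add[OF L] mult_2)
    finally show ?thesis by (simp add: \<rho>_eq algebra_simps)
  qed
  have shift: "(x + c) + (y + c) = 2 * (z + c)" if "x + y = 2 * z" for x y z c :: complex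
    using that by (simp add: algebra_simps)
  from f show ?thesis
  proof (induction arbitrary: i)
    case (first A b)
    then show ?case by (auto simp: activ_def input_layer_axis intro!: mid)
  next
    case (step f A b)
    have "(\<Sum>j<W. A i j * f (axis k 1) j) + (\<Sum>j<W. A i j * f (axis k (-1)) j) =
        2 * (\<Sum>j<W. A i j * f (axis k 0) j)" for i
    proof -
      have "(\<Sum>j<W. A i j * f (axis k 1) j) + (\<Sum>j<W. A i j * f (axis k (-1)) j) =
          (\<Sum>j<W. A i j * (f (axis k 1) j + f (axis k (-1)) j))"
        by (simp add: sum.distrib distrib_left)
      then show ?thesis by (simp add: step.IH sum_distrib_left mult.left_commute)
    qed
    from mid[OF shift[OF this]] show ?case by (simp add: activ_def hidden_layer_def)
  qed
qed

text \<open>On the unit circle \<open>F\<close> is within 1/2 of 1, hence also at 0; but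
  \<open>F 0\<close> has norm below 1/2, and these two discs do not meet.\<close>

lemma entire_not_near_norm:
  assumes hol: "F holomorphic_on UNIV" and near: "\<And>t. norm t \<le> 1 \<Longrightarrow> norm (F t - of_real (norm t)) < 1/2"
  shows False
proof -
  have "norm (F 0 - 1) \<le> 1/2"
  proof (rule maximum_modulus_frontier[of "\<lambda>t. F t - 1" "cball 0 1"])
    show "(\<lambda>t. F t - 1) holomorphic_on interior (cball 0 1)"
      by (intro holomorphic_intros holomorphic_on_subset[OF hol]) auto
    show "continuous_on (closure (cball 0 1)) (\<lambda>t. F t - 1)"
      by (intro continuous_intros continuous_on_subset[OF holomorphic_on_imp_continuous_on[OF hol]]) auto
    show "norm (F t - 1) \<le> 1/2" if "t \<in> frontier (cball 0 1)" for t
      using near[of t] that by (simp add: less_imp_le)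
  qed auto
  moreover have "norm (F 0) < 1/2" using near[of 0] by simp
  moreover have "norm (1::complex) \<le> norm (F 0) + norm (F 0 - 1)"
    by (metis norm_minus_commute norm_triangle_sub)
  ultimately show False by simp
qed

lemma not_universal_NN:
  assumes "\<rho> holomorphic_on UNIV \<or> antiholomorphic \<rho> \<or> R_affine \<rho>"
  shows "\<not> universal (NN \<rho> W :: (complex^'n::finite \<Rightarrow> complex^'m::finite) set)"
proof
  assume U: "universal (NN \<rho> W :: (complex^'n \<Rightarrow> complex^'m) set)"
  fix k :: 'n and l :: 'm
  \<comment> \<open>Every coordinate of the target is the norm, so any output coordinate
    \<open>l\<close> and any input axis \<open>k\<close> yield the function \<open>norm t\<close> of
    one complex variable.\<close>
  define g :: "complex^'n \<Rightarrow> complex^'m" where "g z = (\<chi> i. of_real (norm z))" for z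
  have "continuous_on UNIV g" unfolding g_def by (intro continuous_intros)
  then obtain f where "f \<in> NN \<rho> W" and near: "\<And>z. norm z \<le> 1 \<Longrightarrow> norm (f z - g z) < 1/2"
    using U unfolding universal_def by (metis compact_cball half_gt_zero mem_cball_0 zero_less_one)
  then obtain A b h where f: "f = output_layer W A b \<circ> h" and h: "h \<in> hidden_part \<rho> W"
    by (auto simp: NN_def)
  define F where "F t = f (axis k t) $ l" for t
  have F: "F t = (\<Sum>j<W. A l j * h (axis k t) j) + b $ l" for t
    by (simp add: F_def f output_layer_def)
  have nearF: "norm (F t - of_real (norm t)) < 1/2" if "norm t \<le> 1" for t
  proof -
    have "norm ((f (axis k t) - g (axis k t)) $ l) \<le> norm (f (axis k t) - g (axis k t))"
      by (rule Finite_Cartesian_Product.norm_nth_le)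
    also have "\<dots> < 1/2" using that by (intro near) (simp add: norm_axis_complex)
    finally have "norm ((f (axis k t) - g (axis k t)) $ l) < 1/2" .
    then show ?thesis by (simp add: F_def g_def norm_axis_complex)
  qed
  have entire: False if "\<And>i. (\<lambda>t. h (axis k t) i) holomorphic_on UNIV"
    by (rule entire_not_near_norm[OF _ nearF]) (auto simp: F[abs_def] intro!: holomorphic_intros that)
  from assms show False
  proof (elim disjE)
    assume "\<rho> holomorphic_on UNIV"
    then show False using hidden_part_holomorphic[OF _ h] entire by blast
  next
    assume "antiholomorphic \<rho>"
    then consider "\<And>i. (\<lambda>t. h (axis k t) i) holomorphic_on UNIV"
      | "\<And>i. (\<lambda>t. cnj (h (axis k t) i)) holomorphic_on UNIV"
      using hidden_part_antiholomorphic[OF _ h] by blast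
    then show False
    proof cases
      case 2
      \<comment> \<open>\<open>norm t\<close> is real, so conjugation keeps the distance to
        it.\<close>
      have "norm (cnj (F t) - of_real (norm t)) < 1/2" if "norm t \<le> 1" for t
        using nearF[OF that] by (metis complex_cnj_complex_of_real complex_cnj_diff complex_mod_cnj)
      then show False
        by (intro entire_not_near_norm[of "\<lambda>t. cnj (F t)"]) (auto simp: F intro!: holomorphic_intros 2)
    qed (rule entire)
  next
    assume "R_affine \<rho>"
    then have *: "h (axis k 1) i + h (axis k (-1)) i = 2 * h (axis k 0) i" for i
      by (rule hidden_part_R_affine[OF _ h])
    have "(\<Sum>j<W. A l j * h (axis k 1) j) + (\<Sum>j<W. A l j * h (axis k (-1)) j) =
        (\<Sum>j<W. A l j * (h (axis k 1) j + h (axis k (-1)) j))"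
      by (simp add: sum.distrib distrib_left)
    also have "\<dots> = 2 * (\<Sum>j<W. A l j * h (axis k 0) j)"
      by (simp add: * sum_distrib_left mult.left_commute)
    finally have "F 1 + F (-1) = 2 * F 0"
      unfolding F by simp
    \<comment> \<open>Exact values 1, 0, 1 would violate the midpoint identity by 2, whereas the
      errors amount to less than 2 * 1/2 + 1/2 + 1/2.\<close>
    then have "2 * F 0 - (F 1 - 1) - (F (-1) - 1) = 2" by (simp add: algebra_simps)
    moreover have "norm (2 * F 0 - (F 1 - 1) - (F (-1) - 1)) \<le>
        norm (2 * F 0) + norm (F 1 - 1) + norm (F (-1) - 1)"
      by (intro norm_triangle_le_diff add_right_mono norm_triangle_ineq4)
    ultimately show False
      using nearF[of 0] nearF[of 1] nearF[of "-1"] by (simp add: norm_mult)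
  qed
qed

section \<open>Transporting registers through a layer\<close>

definition compact_closure ::
    "('a::topological_space \<Rightarrow> 'b::real_normed_vector) set \<Rightarrow> ('a \<Rightarrow> 'b) set" where
  "compact_closure F = {f. continuous_on UNIV f \<and>
     (\<forall>K \<epsilon>. compact K \<longrightarrow> \<epsilon> > 0 \<longrightarrow> (\<exists>g\<in>F. \<forall>z\<in>K. norm (g z - f z) < \<epsilon>))}"

lemma compact_closureI:
  assumes "continuous_on UNIV f"
    and "\<And>K \<epsilon>. compact K \<Longrightarrow> \<epsilon> > 0 \<Longrightarrow> \<exists>g\<in>F. \<forall>z\<in>K. norm (g z - f z) < \<epsilon>"
  shows "f \<in> compact_closure F"
  using assms by (simp add: compact_closure_def)

lemma compact_closure_continuous: "f \<in> compact_closure F \<Longrightarrow> continuous_on S f"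
  by (auto simp: compact_closure_def intro: continuous_on_subset)

lemma compact_closureE:
  assumes "f \<in> compact_closure F" "compact K" "\<epsilon> > 0"
  obtains g where "g \<in> F" "\<And>z. z \<in> K \<Longrightarrow> norm (g z - f z) < \<epsilon>"
proof -
  have "\<exists>g\<in>F. \<forall>z\<in>K. norm (g z - f z) < \<epsilon>" using assms by (simp add: compact_closure_def)
  then show ?thesis using that by blast
qed

lemma compact_closure_mono:
  assumes "F \<subseteq> G" "f \<in> compact_closure F"
  shows "f \<in> compact_closure G"
proof (rule compact_closureI)
  fix K :: "'a set" and \<epsilon> :: real assume "compact K" "\<epsilon> > 0"
  then obtain g where "g \<in> F" "\<And>z. z \<in> K \<Longrightarrow> norm (g z - f z) < \<epsilon>"
    using compact_closureE[OF assms(2)] by blast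
  then show "\<exists>g\<in>G. \<forall>z\<in>K. norm (g z - f z) < \<epsilon>" using assms(1) by blast
qed (rule compact_closure_continuous[OF assms(2)])

lemma compact_closure_incl: "f \<in> F \<Longrightarrow> continuous_on UNIV f \<Longrightarrow> f \<in> compact_closure F"
  by (auto simp: compact_closure_def intro!: bexI[of _ f])

text \<open>Idempotence of the closure. It lets every stage of the computation work with exact
  limits, so that no error has to be tracked through the depth of a network.\<close>

lemma compact_closure_limit:
  assumes "continuous_on UNIV f"
    and lim: "\<And>K \<epsilon>. compact K \<Longrightarrow> \<epsilon> > 0 \<Longrightarrow> \<exists>g\<in>compact_closure F. \<forall>z\<in>K. norm (g z - f z) < \<epsilon>"
  shows "f \<in> compact_closure F"
proof (rule compact_closureI)
  fix K :: "'a set" and \<epsilon> :: real assume K: "compact K" and "\<epsilon> > 0"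
  then have "\<epsilon> / 2 > 0" by simp
  then obtain g where g: "g \<in> compact_closure F" "\<And>z. z \<in> K \<Longrightarrow> norm (g z - f z) < \<epsilon> / 2"
    using lim[OF K] by blast
  obtain h where h: "h \<in> F" "\<And>z. z \<in> K \<Longrightarrow> norm (h z - g z) < \<epsilon> / 2"
    using compact_closureE[OF g(1) K \<open>\<epsilon> / 2 > 0\<close>] by blast
  show "\<exists>g\<in>F. \<forall>z\<in>K. norm (g z - f z) < \<epsilon>"
    using h g norm_diff_triangle_less[of _ _ "\<epsilon>/2" _ "\<epsilon>/2"] by (metis field_sum_of_halves)
qed fact

text \<open>With \<open>g\<close> near \<open>G\<close> on a compact ball and \<open>h\<close> near
  \<open>f\<close>, uniform continuity of \<open>G\<close> on the ball controls the propagated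
  error. This allows layers to be idealised one at a time.\<close>

lemma compact_closure_compose:
  fixes f :: "'a::topological_space \<Rightarrow> 'b::euclidean_space" and G :: "'b \<Rightarrow> 'c::real_normed_vector"
  assumes f: "f \<in> compact_closure F" and G: "G \<in> compact_closure H"
    and comp: "\<And>f g. f \<in> F \<Longrightarrow> g \<in> H \<Longrightarrow> g \<circ> f \<in> F'"
  shows "G \<circ> f \<in> compact_closure F'"
proof (rule compact_closureI)
  show "continuous_on UNIV (G \<circ> f)"
    using compact_closure_continuous[OF f] compact_closure_continuous[OF G]
    by (rule continuous_on_compose)
  fix K :: "'a set" and \<epsilon> :: real assume K: "compact K" and "\<epsilon> > 0"
  then have \<epsilon>: "\<epsilon> / 2 > 0" by simp
  have "compact (f ` K)"
    using compact_closure_continuous[OF f] K by (rule compact_continuous_image)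
  then obtain R where R: "\<And>z. z \<in> K \<Longrightarrow> norm (f z) \<le> R"
    by (metis compact_imp_bounded bounded_iff imageI)
  \<comment> \<open>The margin 1 keeps the values of the approximant of \<open>f\<close>, chosen
    within \<open>min \<delta> 1\<close>, in the ball.\<close>
  define B where "B = cball (0::'b) (R + 1)"
  have B: "compact B" by (simp add: B_def)
  obtain g where g: "g \<in> H" "\<And>x. x \<in> B \<Longrightarrow> norm (g x - G x) < \<epsilon> / 2"
    using compact_closureE[OF G B \<epsilon>] by blast
  have "uniformly_continuous_on B G"
    using compact_closure_continuous[OF G] B by (rule compact_uniformly_continuous)
  then obtain \<delta> where \<delta>: "\<delta> > 0"
      "\<And>x y. x \<in> B \<Longrightarrow> y \<in> B \<Longrightarrow> dist y x < \<delta> \<Longrightarrow> dist (G y) (G x) < \<epsilon> / 2"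
    using \<epsilon> unfolding uniformly_continuous_on_def by metis
  obtain h where h: "h \<in> F" "\<And>z. z \<in> K \<Longrightarrow> norm (h z - f z) < min \<delta> 1"
    using compact_closureE[OF f K, of "min \<delta> 1"] \<delta>(1) by auto
  have "norm ((g \<circ> h) z - (G \<circ> f) z) < \<epsilon>" if "z \<in> K" for z
  proof -
    have fB: "f z \<in> B" using R[OF that] by (simp add: B_def)
    have hB: "h z \<in> B"
      using R[OF that] h(2)[OF that] norm_triangle_sub[of "h z" "f z"] by (simp add: B_def)
    have "norm (G (h z) - G (f z)) < \<epsilon> / 2"
      using \<delta>(2)[OF fB hB] h(2)[OF that] by (simp add: dist_norm)
    with g(2)[OF hB] have "norm (g (h z) - G (f z)) < \<epsilon> / 2 + \<epsilon> / 2"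
      by (rule norm_diff_triangle_less)
    then show ?thesis by simp
  qed
  then show "\<exists>g\<in>F'. \<forall>z\<in>K. norm (g z - (G \<circ> f) z) < \<epsilon>"
    using comp[OF h(1) g(1)] by blast
qed

lemma universal_iff_compact_closure:
  "universal F \<longleftrightarrow> (\<forall>g. continuous_on UNIV g \<longrightarrow> g \<in> compact_closure F)"
  by (auto simp: universal_def compact_closure_def)

section \<open>Networks built from blocks with one hidden layer\<close>

definition shallow_nets :: "(complex \<Rightarrow> complex) \<Rightarrow> nat \<Rightarrow> (complex^'r::finite \<Rightarrow> complex^'s::finite) set" where
  "shallow_nets \<rho> W = {output_layer W A b \<circ> activ W \<rho> \<circ> input_layer W D e | A b D e. True}"

lemma shallow_nets_subset_NN: "shallow_nets \<rho> W \<subseteq> NN \<rho> W"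
  unfolding shallow_nets_def NN_def comp_assoc using hidden_part.first by blast

lemma input_output_layer:
  "input_layer W D e (output_layer W A b x) =
   hidden_layer W (\<lambda>i j. \<Sum>r\<in>UNIV. D i r * A r j) (\<lambda>i. (\<Sum>r\<in>UNIV. D i r * b $ r) + e i) x"
proof
  fix i
  have "(\<Sum>r\<in>UNIV. D i r * ((\<Sum>j<W. A r j * x j) + b $ r)) =
      (\<Sum>j<W. (\<Sum>r\<in>UNIV. D i r * A r j) * x j) + (\<Sum>r\<in>UNIV. D i r * b $ r)"
    by (simp add: distrib_left sum.distrib sum_distrib_left sum_distrib_right mult.assoc)
      (rule sum.swap)
  then show "input_layer W D e (output_layer W A b x) i =
    hidden_layer W (\<lambda>i j. \<Sum>r\<in>UNIV. D i r * A r j) (\<lambda>i. (\<Sum>r\<in>UNIV. D i r * b $ r) + e i) x i"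
    by (simp add: input_layer_def output_layer_def hidden_layer_def)
qed

text \<open>The output map of \<open>f\<close> and the input map of \<open>g\<close> merge into one
  affine map between hidden layers. The intermediate vector is never a layer itself, so its
  dimension is not limited by \<open>W\<close>.\<close>

lemma NN_compose_shallow_nets:
  assumes "f \<in> NN \<rho> W" "g \<in> shallow_nets \<rho> W"
  shows "g \<circ> f \<in> NN \<rho> W"
proof -
  obtain A b h where f: "f = output_layer W A b \<circ> h" and h: "h \<in> hidden_part \<rho> W"
    using assms(1) by (auto simp: NN_def)
  obtain A' b' D e where g: "g = output_layer W A' b' \<circ> activ W \<rho> \<circ> input_layer W D e"
    using assms(2) by (auto simp: shallow_nets_def)
  have "g \<circ> f = output_layer W A' b' \<circ> (activ W \<rho> \<circ> hidden_layer W (\<lambda>i j. \<Sum>r\<in>UNIV. D i r * A r j)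
      (\<lambda>i. (\<Sum>r\<in>UNIV. D i r * b $ r) + e i) \<circ> h)"
    by (simp add: f g fun_eq_iff input_output_layer)
  then show ?thesis
    unfolding NN_def using hidden_part.step[OF h] by blast
qed

text \<open>Lets neurons be labelled by any finite type with at most \<open>W\<close> elements;
  registers times \<open>bool\<close>, plus one, will be such a type.\<close>

lemma shallow_netsI:
  fixes C :: "'s::finite \<Rightarrow> 'w::finite \<Rightarrow> complex" and D :: "'w \<Rightarrow> 'r::finite \<Rightarrow> complex"
  assumes W: "CARD('w) \<le> W"
  shows "(\<lambda>u. \<chi> s. (\<Sum>w\<in>UNIV. C s w * \<rho> ((\<Sum>r\<in>UNIV. D w r * u $ r) + e w)) + d $ s) \<in> shallow_nets \<rho> W"
proof -
  obtain idx :: "'w \<Rightarrow> nat" where idx: "bij_betw idx UNIV {..<CARD('w)}"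
    using ex_bij_betw_finite_nat[of "UNIV :: 'w set"] by (auto simp: atLeast0LessThan)
  then have inj: "inj idx" by (simp add: bij_betw_def)
  have range: "range idx = {..<CARD('w)}" using idx by (simp add: bij_betw_def)
  \<comment> \<open>Neurons outside the range of \<open>idx\<close> compute something irrelevant and
    get outgoing weight 0.\<close>
  define A where "A s j = (if j \<in> range idx then C s (inv idx j) else 0)" for s j
  have "(output_layer W A d \<circ> activ W \<rho> \<circ> input_layer W (D \<circ> inv idx) (e \<circ> inv idx)) u $ s =
      (\<Sum>w\<in>UNIV. C s w * \<rho> ((\<Sum>r\<in>UNIV. D w r * u $ r) + e w)) + d $ s" for u :: "complex^'r" and s
  proof -
    define x where "x = activ W \<rho> (input_layer W (D \<circ> inv idx) (e \<circ> inv idx) u)"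
    have "(\<Sum>j<W. A s j * x j) = (\<Sum>j\<in>range idx. A s j * x j)"
      using W range by (intro sum.mono_neutral_right) (auto simp: A_def)
    also have "\<dots> = (\<Sum>w\<in>UNIV. A s (idx w) * x (idx w))"
      by (simp add: sum.reindex[OF inj])
    also have "\<dots> = (\<Sum>w\<in>UNIV. C s w * \<rho> ((\<Sum>r\<in>UNIV. D w r * u $ r) + e w))"
    proof (rule sum.cong)
      fix w
      have "idx w < W" using range W by (metis lessThan_iff order_less_le_trans rangeI)
      then show "A s (idx w) * x (idx w) = C s w * \<rho> ((\<Sum>r\<in>UNIV. D w r * u $ r) + e w)"
        by (simp add: A_def x_def activ_def input_layer_def inv_f_f[OF inj])
    qed simp
    finally show ?thesis by (simp add: output_layer_def x_def)
  qed
  then have "(\<lambda>u. \<chi> s. (\<Sum>w\<in>UNIV. C s w * \<rho> ((\<Sum>r\<in>UNIV. D w r * u $ r) + e w)) + d $ s) =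
      output_layer W A d \<circ> activ W \<rho> \<circ> input_layer W (D \<circ> inv idx) (e \<circ> inv idx)"
    by (simp add: fun_eq_iff vec_eq_iff)
  then show ?thesis by (auto simp: shallow_nets_def)
qed

section \<open>The derivative of the activation as a register transport\<close>

definition two_neuron_approx :: "(complex \<Rightarrow> complex) \<Rightarrow> (complex \<Rightarrow> complex) \<Rightarrow> bool" where
  "two_neuron_approx \<rho> \<kappa> \<longleftrightarrow> continuous_on UNIV \<kappa> \<and> (\<forall>R \<epsilon>. \<epsilon> > 0 \<longrightarrow>
     (\<exists>c \<alpha> \<beta> d. \<forall>w. norm w \<le> R \<longrightarrow> norm ((\<Sum>t\<in>(UNIV::bool set). c t * \<rho> (\<alpha> t * w + \<beta> t)) + d - \<kappa> w) < \<epsilon>))"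

text \<open>Each coordinate is transported by two neurons; the last neuron evaluates \<open>\<rho>\<close> at an
  arbitrary affine functional.\<close>

lemma register_step_in_closure_shallow:
  fixes M :: "'s::finite \<Rightarrow> 'r::finite \<Rightarrow> complex" and c d :: "complex^'s"
  assumes \<kappa>: "two_neuron_approx \<rho> \<kappa>" and \<rho>: "continuous_on UNIV \<rho>" and W: "2 * CARD('r) + 1 \<le> W"
  shows "(\<lambda>u. \<chi> s. (\<Sum>r\<in>UNIV. M s r * \<kappa> (u $ r)) + c $ s * \<rho> ((\<Sum>r\<in>UNIV. a r * u $ r) + b) + d $ s)
         \<in> compact_closure (shallow_nets \<rho> W)" (is "?G \<in> _")
proof (rule compact_closureI)
  have cont\<kappa>: "continuous_on UNIV (\<lambda>x. \<kappa> (f x))" if "continuous_on UNIV f" for f :: "complex^'r \<Rightarrow> complex"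
    using \<kappa> continuous_on_compose2[OF _ that, of UNIV \<kappa>] by (simp add: two_neuron_approx_def)
  have cont\<rho>: "continuous_on UNIV (\<lambda>x. \<rho> (f x))" if "continuous_on UNIV f" for f :: "complex^'r \<Rightarrow> complex"
    using continuous_on_compose2[OF \<rho> that] by simp
  show "continuous_on UNIV ?G"
    by (intro continuous_intros cont\<kappa> cont\<rho>)
  fix K :: "(complex^'r) set" and \<epsilon> :: real assume K: "compact K" and "\<epsilon> > 0"
  obtain R where R: "\<And>u. u \<in> K \<Longrightarrow> norm u \<le> R"
    using compact_imp_bounded[OF K] by (auto simp: bounded_iff)
  \<comment> \<open>Bounds the total weight with which transport errors reach the output; the added
    1 keeps it positive and makes the final bound strict.\<close>
  define B where "B = (\<Sum>s\<in>UNIV. \<Sum>r\<in>UNIV. norm (M s r)) + 1"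
  have "B > 0" unfolding B_def by (intro add_nonneg_pos sum_nonneg) auto
  then have "\<epsilon> / B > 0" using \<open>\<epsilon> > 0\<close> by simp
  with \<kappa> obtain q \<alpha> \<beta> p where q:
    "\<And>w. norm w \<le> R \<Longrightarrow> norm ((\<Sum>t\<in>(UNIV::bool set). q t * \<rho> (\<alpha> t * w + \<beta> t)) + p - \<kappa> w) < \<epsilon> / B"
    unfolding two_neuron_approx_def by meson
  define T where "T w = (\<Sum>t\<in>(UNIV::bool set). q t * \<rho> (\<alpha> t * w + \<beta> t))" for w
  \<comment> \<open>\<open>None\<close> is the free neuron; \<open>Some (r, t)\<close> with
    \<open>t :: bool\<close> is one of the two neurons that carry register \<open>r\<close>.\<close>
  define C :: "'s \<Rightarrow> ('r \<times> bool) option \<Rightarrow> complex"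
    where "C s w = (case w of None \<Rightarrow> c $ s | Some (r, t) \<Rightarrow> M s r * q t)" for s w
  define D where "D w r' = (case w of None \<Rightarrow> a r' | Some (r, t) \<Rightarrow> if r' = r then \<alpha> t else 0)"
    for w :: "('r \<times> bool) option" and r'
  define e where "e w = (case w of None \<Rightarrow> b | Some (r, t) \<Rightarrow> \<beta> t)" for w :: "('r \<times> bool) option"
  \<comment> \<open>Each transport has a constant term \<open>p\<close>; its weighted copies go into
    the output bias.\<close>
  define d' where "d' = (\<chi> s. d $ s + (\<Sum>r\<in>UNIV. M s r * p))"
  define g where
    "g u = (\<chi> s. (\<Sum>w\<in>UNIV. C s w * \<rho> ((\<Sum>r\<in>UNIV. D w r * u $ r) + e w)) + d' $ s)" for u
  have "CARD(('r \<times> bool) option) \<le> W"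
    using W by (simp add: card_UNIV_option)
  then have "g \<in> shallow_nets \<rho> W"
    unfolding g_def by (rule shallow_netsI)
  moreover have "norm (g u - ?G u) < \<epsilon>" if "u \<in> K" for u
  proof -
    have neuron: "(\<Sum>r'\<in>UNIV. D (Some (r, t)) r' * u $ r') = \<alpha> t * u $ r" for r t
      by (simp add: D_def if_distrib[of "\<lambda>x. x * _"] cong: if_cong)
    have g_eq: "g u $ s = (\<Sum>r\<in>UNIV. M s r * (T (u $ r) + p))
        + c $ s * \<rho> ((\<Sum>r\<in>UNIV. a r * u $ r) + b) + d $ s" for s
    proof -
      let ?F = "\<lambda>w. C s w * \<rho> ((\<Sum>r\<in>UNIV. D w r * u $ r) + e w)"
      have "(\<Sum>w\<in>UNIV. ?F w) = ?F None + (\<Sum>w\<in>UNIV. ?F (Some w))"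
        by (simp add: UNIV_option_conv sum.reindex)
      also have "(\<Sum>w\<in>UNIV. ?F (Some w)) = (\<Sum>(r, t)\<in>UNIV. M s r * q t * \<rho> (\<alpha> t * u $ r + \<beta> t))"
        by (intro sum.cong refl, clarify) (simp only: neuron, simp add: C_def e_def)
      also have "\<dots> = (\<Sum>r\<in>UNIV. M s r * T (u $ r))"
        by (simp add: T_def sum_distrib_left mult.assoc flip: UNIV_Times_UNIV sum.cartesian_product
            del: UNIV_Times_UNIV)
      finally show ?thesis
        by (simp add: g_def d'_def C_def D_def e_def distrib_left sum.distrib)
    qed
    have "norm (g u - ?G u) \<le> (\<Sum>s\<in>UNIV. norm ((g u - ?G u) $ s))"
      by (simp add: norm_vec_def L2_set_le_sum)
    also have "\<dots> \<le> (\<Sum>s\<in>UNIV. \<Sum>r\<in>UNIV. norm (M s r) * (\<epsilon> / B))"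
    proof (rule sum_mono)
      fix s
      have "(g u - ?G u) $ s = (\<Sum>r\<in>UNIV. M s r * (T (u $ r) + p)) - (\<Sum>r\<in>UNIV. M s r * \<kappa> (u $ r))"
        by (simp add: g_eq)
      also have "\<dots> = (\<Sum>r\<in>UNIV. M s r * (T (u $ r) + p - \<kappa> (u $ r)))"
        by (simp add: right_diff_distrib sum_subtractf)
      also have "norm \<dots> \<le> (\<Sum>r\<in>UNIV. norm (M s r * (T (u $ r) + p - \<kappa> (u $ r))))"
        by (rule norm_sum)
      also have "\<dots> \<le> (\<Sum>r\<in>UNIV. norm (M s r) * (\<epsilon> / B))"
      proof (rule sum_mono)
        fix r
        have "norm (u $ r) \<le> R"
          using R[OF that] Finite_Cartesian_Product.norm_nth_le[of u r] by linarith
        from q[OF this] have "norm (T (u $ r) + p - \<kappa> (u $ r)) \<le> \<epsilon> / B"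
          by (simp add: T_def less_imp_le)
        then show "norm (M s r * (T (u $ r) + p - \<kappa> (u $ r))) \<le> norm (M s r) * (\<epsilon> / B)"
          unfolding norm_mult by (rule mult_left_mono) simp
      qed
      finally show "norm ((g u - ?G u) $ s) \<le> (\<Sum>r\<in>UNIV. norm (M s r) * (\<epsilon> / B))" .
    qed
    also have "\<dots> = (\<Sum>s\<in>UNIV. \<Sum>r\<in>UNIV. norm (M s r)) * (\<epsilon> / B)"
      by (simp only: sum_distrib_right)
    also have "\<dots> = (B - 1) * (\<epsilon> / B)"
      by (simp add: B_def)
    also have "\<dots> < \<epsilon>"
      using \<open>B > 0\<close> \<open>\<epsilon> > 0\<close> by (simp add: field_simps)
    finally show ?thesis .
  qed
  ultimately show "\<exists>g\<in>shallow_nets \<rho> W. \<forall>u\<in>K. norm (g u - ?G u) < \<epsilon>" by blast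
qed

text \<open>Zooming in: \<open>\<rho> (z0 + h) - \<rho> z0\<close> is the real-linear derivative at
  \<open>h\<close> up to o(h). Taking \<open>h = \<eta> w\<close> and
  \<open>h = \<i> \<eta> w\<close>, combining with weights 1 and \<open>s\<close> and dividing by
  \<open>\<gamma> \<eta>\<close> leaves \<open>\<kappa> w\<close> and an error that tends to 0 with
  \<eta>.\<close>

lemma two_neuron_approx_of_derivative:
  assumes \<rho>: "real_diff_at \<rho> z0 px py" and \<kappa>: "continuous_on UNIV \<kappa>"
    and \<gamma>: "\<gamma> \<noteq> 0" and s: "norm s = 1"
    and eq: "\<And>w. (px * of_real (Re w) + py * of_real (Im w)) +
        s * (px * of_real (Re (\<i> * w)) + py * of_real (Im (\<i> * w))) = \<gamma> * \<kappa> w"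
  shows "two_neuron_approx \<rho> \<kappa>"
  unfolding two_neuron_approx_def
proof (intro conjI allI impI)
  fix R \<epsilon> :: real assume "\<epsilon> > 0"
  define A where "A w = px * of_real (Re w) + py * of_real (Im w)" for w
  define E where "E h = \<rho> (z0 + h) - \<rho> z0 - A h" for h
  \<comment> \<open>Two remainders of size at most \<open>\<epsilon>' \<eta> \<bar>R\<bar>\<close>
    are divided by \<open>norm \<gamma> * \<eta>\<close>; the factor 1/4 leaves half of \<epsilon>
    as slack. The denominator \<open>\<bar>R\<bar> + 1\<close> also serves
    \<open>R \<le> 0\<close>.\<close>
  define \<epsilon>' where "\<epsilon>' = \<epsilon> / 4 * norm \<gamma> / (\<bar>R\<bar> + 1)"
  have "\<epsilon>' > 0" using \<open>\<epsilon> > 0\<close> \<gamma> by (simp add: \<epsilon>'_def)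
  have "((\<lambda>h. E h / h) \<longlongrightarrow> 0) (at 0)"
    using \<rho> by (simp add: real_diff_at_def E_def A_def diff_diff_eq add.assoc)
  from tendstoD[OF this \<open>\<epsilon>' > 0\<close>] obtain \<delta> where \<delta>: "\<delta> > 0"
      "\<And>h. h \<noteq> 0 \<Longrightarrow> norm h < \<delta> \<Longrightarrow> norm (E h / h) < \<epsilon>'"
    by (auto simp: eventually_at)
  have E: "norm (E h) \<le> \<epsilon>' * norm h" if "norm h < \<delta>" for h
  proof (cases "h = 0")
    case True
    then show ?thesis by (simp add: E_def A_def)
  next
    case False
    then show ?thesis using \<delta>(2)[OF False that] by (simp add: norm_divide field_simps)
  qed
  define \<eta> where "\<eta> = \<delta> / (\<bar>R\<bar> + 1)"
  have \<eta>: "\<eta> > 0" using \<delta>(1) by (simp add: \<eta>_def)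
  define c where "c t = (if t then 1 else s) / (\<gamma> * of_real \<eta>)" for t
  define \<alpha> where "\<alpha> t = (if t then 1 else \<i>) * of_real \<eta>" for t
  have bound: "norm ((\<Sum>t\<in>(UNIV::bool set). c t * \<rho> (\<alpha> t * w + z0)) + (- (1 + s) * \<rho> z0 / (\<gamma> * of_real \<eta>)) - \<kappa> w) < \<epsilon>"
    if w: "norm w \<le> R" for w
  proof -
    have A_scale: "A (of_real \<eta> * w) = of_real \<eta> * A w" for w
      by (simp add: A_def algebra_simps)
    have "\<gamma> * of_real \<eta> * \<kappa> w = A (of_real \<eta> * w) + s * A (\<i> * of_real \<eta> * w)"
      using arg_cong[OF eq[of w], of "\<lambda>x. of_real \<eta> * x"] A_scale[of w] A_scale[of "\<i> * w"]
      unfolding A_def[symmetric] by (simp add: algebra_simps)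
    then have \<kappa>w: "\<kappa> w = (A (of_real \<eta> * w) + s * A (\<i> * of_real \<eta> * w)) / (\<gamma> * of_real \<eta>)"
      using \<gamma> \<eta> by (simp add: field_simps)
    have "(\<Sum>t\<in>(UNIV::bool set). c t * \<rho> (\<alpha> t * w + z0)) + (- (1 + s) * \<rho> z0 / (\<gamma> * of_real \<eta>)) - \<kappa> w =
        (E (of_real \<eta> * w) + s * E (\<i> * of_real \<eta> * w)) / (\<gamma> * of_real \<eta>)"
      unfolding \<kappa>w by (simp add: UNIV_bool c_def \<alpha>_def E_def add_divide_distrib diff_divide_distrib
          algebra_simps)
    also have "norm \<dots> = norm (E (of_real \<eta> * w) + s * E (\<i> * of_real \<eta> * w)) / (norm \<gamma> * \<eta>)"
      using \<eta> by (simp add: norm_divide norm_mult)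
    also have "\<dots> \<le> (\<epsilon>' * (\<eta> * \<bar>R\<bar>) + \<epsilon>' * (\<eta> * \<bar>R\<bar>)) / (norm \<gamma> * \<eta>)"
    proof (intro divide_right_mono norm_triangle_le add_mono)
      have "\<eta> * norm w \<le> \<eta> * \<bar>R\<bar>" using w \<eta> by simp
      moreover have "\<eta> * \<bar>R\<bar> < \<delta>" using \<delta>(1) by (simp add: \<eta>_def field_simps)
      ultimately have small: "norm (E h) \<le> \<epsilon>' * (\<eta> * \<bar>R\<bar>)" if "norm h = \<eta> * norm w" for h
        using E[of h] that \<open>\<epsilon>' > 0\<close> by (smt (verit) mult_left_mono)
      show "norm (E (of_real \<eta> * w)) \<le> \<epsilon>' * (\<eta> * \<bar>R\<bar>)"
        using \<eta> by (intro small) (simp add: norm_mult)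
      show "norm (s * E (\<i> * of_real \<eta> * w)) \<le> \<epsilon>' * (\<eta> * \<bar>R\<bar>)"
        using \<eta> s small[of "\<i> * of_real \<eta> * w"] by (simp add: norm_mult)
    qed (use \<eta> in auto)
    also have "\<dots> = 2 * \<epsilon>' * \<bar>R\<bar> / norm \<gamma>"
      using \<gamma> \<eta> by (simp add: field_simps)
    also have "\<dots> < \<epsilon>"
    proof -
      have "\<epsilon>' * \<bar>R\<bar> \<le> \<epsilon>' * (\<bar>R\<bar> + 1)" using \<open>\<epsilon>' > 0\<close> by simp
      also have "\<dots> = \<epsilon> / 4 * norm \<gamma>"
        unfolding \<epsilon>'_def by (intro nonzero_eq_divide_eq[THEN iffD1]) auto
      finally have "2 * \<epsilon>' * \<bar>R\<bar> \<le> \<epsilon> * norm \<gamma> / 2" by simp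
      also have "\<dots> < \<epsilon> * norm \<gamma>" using \<open>\<epsilon> > 0\<close> \<gamma> by simp
      finally show ?thesis using \<gamma> by (simp add: divide_less_eq)
    qed
    finally show ?thesis .
  qed
  show "\<exists>c \<alpha> \<beta> d. \<forall>w. norm w \<le> R \<longrightarrow>
      norm ((\<Sum>t\<in>(UNIV::bool set). c t * \<rho> (\<alpha> t * w + \<beta> t)) + d - \<kappa> w) < \<epsilon>"
    by (rule exI[of _ c], rule exI[of _ \<alpha>], rule exI[of _ "\<lambda>_. z0"],
        rule exI[of _ "- (1 + s) * \<rho> z0 / (\<gamma> * of_real \<eta>)"]) (intro allI impI bound)
qed (rule \<kappa>)

text \<open>Twice the derivative at \<open>z0\<close> is \<open>(px - \<i> py) w + (px + \<i> py) cnj w\<close>; evaluating it at \<open>w\<close> and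
  \<open>\<i> w\<close> separates the two summands.\<close>

lemma two_neuron_approx_id_or_cnj:
  assumes \<rho>: "real_diff_at \<rho> z0 px py" and nz: "(px, py) \<noteq> (0, 0)"
  shows "two_neuron_approx \<rho> (\<lambda>w. w) \<or> two_neuron_approx \<rho> cnj"
proof -
  have "px - \<i> * py \<noteq> 0 \<or> px + \<i> * py \<noteq> 0"
  proof (rule ccontr)
    assume "\<not> ?thesis"
    then have "px - \<i> * py = 0" "px + \<i> * py = 0" by auto
    then have "2 * px = 0" "2 * \<i> * py = 0" by (simp_all add: algebra_simps)
    then show False using nz by simp
  qed
  then show ?thesis
  proof
    assume nz: "px - \<i> * py \<noteq> 0"
    have "two_neuron_approx \<rho> (\<lambda>w. w)"
    proof (rule two_neuron_approx_of_derivative[OF \<rho> _ nz, of _ "- \<i>"])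
      show "(px * of_real (Re w) + py * of_real (Im w)) +
        - \<i> * (px * of_real (Re (\<i> * w)) + py * of_real (Im (\<i> * w))) = (px - \<i> * py) * w" for w
        by (simp add: complex_eq_iff algebra_simps)
    qed auto
    then show ?thesis ..
  next
    assume nz: "px + \<i> * py \<noteq> 0"
    have "two_neuron_approx \<rho> cnj"
    proof (rule two_neuron_approx_of_derivative[OF \<rho> _ nz, of _ "\<i>"])
      show "(px * of_real (Re w) + py * of_real (Im w)) +
        \<i> * (px * of_real (Re (\<i> * w)) + py * of_real (Im (\<i> * w))) = (px + \<i> * py) * cnj w" for w
        by (simp add: complex_eq_iff algebra_simps)
    qed (auto intro: linear_continuous_on bounded_linear_cnj)
    then show ?thesis ..
  qed
qed

text \<open>The interface between networks and computation: reading the input linearly, and one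
  layer whose free neuron is \<sigma>. Both kinds of transport provide it, with different \<sigma>,
  and the evaluation of functions in registers uses nothing else about networks.\<close>

definition register_closed ::
    "(complex \<Rightarrow> complex) \<Rightarrow> (complex^'n::finite \<Rightarrow> complex^'r::finite) set \<Rightarrow> bool" where
  "register_closed \<sigma> C \<longleftrightarrow>
     (\<forall>M. (\<lambda>z. \<chi> s. \<Sum>j\<in>UNIV. M s j * z $ j) \<in> C) \<and>
     (\<forall>f M c a b d. f \<in> C \<longrightarrow>
       (\<lambda>z. \<chi> s. (\<Sum>r\<in>UNIV. M s r * f z $ r) + c $ s * \<sigma> ((\<Sum>r\<in>UNIV. a r * f z $ r) + b) + d $ s) \<in> C)"

text \<open>The new layer must carry the old registers, so the width requirement concerns
  \<open>'r\<close>; the number of new registers is free.\<close>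

lemma NN_register_step:
  fixes f :: "complex^'n::finite \<Rightarrow> complex^'r::finite" and c d :: "complex^'s::finite"
  assumes "two_neuron_approx \<rho> \<kappa>" "continuous_on UNIV \<rho>" "2 * CARD('r) + 1 \<le> W"
    and "f \<in> compact_closure (NN \<rho> W)"
  shows "(\<lambda>z. \<chi> s. (\<Sum>r\<in>UNIV. M s r * \<kappa> (f z $ r)) + c $ s * \<rho> ((\<Sum>r\<in>UNIV. a r * f z $ r) + b) + d $ s)
    \<in> compact_closure (NN \<rho> W)"
proof -
  define G where "G u = (\<chi> s. (\<Sum>r\<in>UNIV. M s r * \<kappa> (u $ r)) + c $ s * \<rho> ((\<Sum>r\<in>UNIV. a r * u $ r) + b) + d $ s)"
    for u :: "complex^'r"
  have "G \<in> compact_closure (shallow_nets \<rho> W)"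
    unfolding G_def by (rule register_step_in_closure_shallow[OF assms(1-3)])
  with assms(4) have "G \<circ> f \<in> compact_closure (NN \<rho> W)"
    by (rule compact_closure_compose) (rule NN_compose_shallow_nets)
  then show ?thesis by (simp only: o_def G_def)
qed

lemma NN_register_closed_id:
  assumes id: "two_neuron_approx \<rho> (\<lambda>w. w)" and \<rho>: "continuous_on UNIV \<rho>"
    and W: "2 * CARD('n::finite) + 1 \<le> W" "2 * CARD('r::finite) + 1 \<le> W"
  shows "register_closed \<rho> (compact_closure (NN \<rho> W) :: (complex^'n \<Rightarrow> complex^'r) set)"
  unfolding register_closed_def
proof (intro conjI allI impI)
  show "(\<lambda>z :: complex^'n. \<chi> s. \<Sum>j\<in>UNIV. M s j * z $ j) \<in> compact_closure (NN \<rho> W)" for M :: "'r \<Rightarrow> 'n \<Rightarrow> complex"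
    using compact_closure_mono[OF shallow_nets_subset_NN
        register_step_in_closure_shallow[OF id \<rho> W(1), of M 0 "\<lambda>_. 0" 0 0]] by simp
  fix f :: "complex^'n \<Rightarrow> complex^'r" and M c a b d
  assume "f \<in> compact_closure (NN \<rho> W)"
  from NN_register_step[OF id \<rho> W(2) this, of M c a b d]
  show "(\<lambda>z. \<chi> s. (\<Sum>r\<in>UNIV. M s r * f z $ r) + c $ s * \<rho> ((\<Sum>r\<in>UNIV. a r * f z $ r) + b) + d $ s)
      \<in> compact_closure (NN \<rho> W)" .
qed

text \<open>Two layers conjugate twice, and the second one sees the conjugated registers; hence the
  activation \<open>\<rho> \<circ> cnj\<close>.\<close>

lemma NN_register_closed_cnj:
  assumes cnj: "two_neuron_approx \<rho> cnj" and \<rho>: "continuous_on UNIV \<rho>"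
    and W: "2 * CARD('n::finite) + 1 \<le> W" "2 * CARD('r::finite) + 1 \<le> W"
  shows "register_closed (\<lambda>w. \<rho> (cnj w)) (compact_closure (NN \<rho> W) :: (complex^'n \<Rightarrow> complex^'r) set)"
  unfolding register_closed_def
proof (intro conjI allI impI)
  have cnj_mem: "(\<lambda>z. \<chi> s. cnj (f z $ s)) \<in> compact_closure (NN \<rho> W)"
    if "f \<in> compact_closure (NN \<rho> W)" for f :: "complex^'n \<Rightarrow> complex^'r"
    using NN_register_step[OF cnj \<rho> W(2) that, of "\<lambda>s r. if s = r then 1 else 0" 0 "\<lambda>_. 0" 0 0]
    by (simp add: if_distrib[of "\<lambda>x. x * _"] cong: if_cong)
  show "(\<lambda>z :: complex^'n. \<chi> s. \<Sum>j\<in>UNIV. M s j * z $ j) \<in> compact_closure (NN \<rho> W)" for M :: "'r \<Rightarrow> 'n \<Rightarrow> complex"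
  proof -
    have "(\<lambda>z :: complex^'n. \<chi> s. \<Sum>j\<in>UNIV. cnj (M s j) * cnj (z $ j)) \<in> compact_closure (NN \<rho> W)"
      using compact_closure_mono[OF shallow_nets_subset_NN
          register_step_in_closure_shallow[OF cnj \<rho> W(1), of "\<lambda>s j. cnj (M s j)" 0 "\<lambda>_. 0" 0 0]]
      by simp
    from cnj_mem[OF this] show ?thesis by simp
  qed
  fix f :: "complex^'n \<Rightarrow> complex^'r" and M c a b d
  assume "f \<in> compact_closure (NN \<rho> W)"
  from NN_register_step[OF cnj \<rho> W(2) cnj_mem[OF this], of M c "\<lambda>r. cnj (a r)" "cnj b" d]
  show "(\<lambda>z. \<chi> s. (\<Sum>r\<in>UNIV. M s r * f z $ r) + c $ s * \<rho> (cnj ((\<Sum>r\<in>UNIV. a r * f z $ r) + b)) + d $ s)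
      \<in> compact_closure (NN \<rho> W)"
    by simp
qed

section \<open>Integral means\<close>

text \<open>Steklov mean over the segment from \<open>z\<close> to \<open>z + v\<close>. Its
  derivative along \<open>v\<close> is the plain difference \<open>f (z + v) - f z\<close>, so
  derivatives of means are explicit in values of \<open>f\<close>.\<close>

definition steklov :: "complex \<Rightarrow> (complex \<Rightarrow> complex) \<Rightarrow> complex \<Rightarrow> complex" where
  "steklov v f z = integral {0..1} (\<lambda>t. f (z + of_real t * v))"

lemma continuous_on_along_line:
  fixes f :: "complex \<Rightarrow> complex"
  assumes "continuous_on UNIV f"
  shows "continuous_on S (\<lambda>t::real. f (z + of_real t * v))"
  by (rule continuous_on_compose2[OF assms]) (auto intro!: continuous_intros)

lemma continuous_on_steklov:
  assumes "continuous_on UNIV f"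
  shows "continuous_on UNIV (steklov v f)"
proof -
  have "continuous_on (UNIV \<times> cbox 0 (1::real)) (\<lambda>(z, t). f (z + of_real t * v))"
    unfolding case_prod_beta by (rule continuous_on_compose2[OF assms]) (auto intro!: continuous_intros)
  from integral_continuous_on_param[OF this] show ?thesis
    by (simp add: steklov_def[abs_def])
qed

lemma steklov_near:
  assumes "continuous_on UNIV f" and near: "\<And>t. 0 \<le> t \<Longrightarrow> t \<le> 1 \<Longrightarrow> norm (f (z + of_real t * v) - c) \<le> \<epsilon>"
  shows "norm (steklov v f z - c) \<le> \<epsilon>"
proof -
  have int: "(\<lambda>t::real. f (z + of_real t * v)) integrable_on {0..1}"
    by (intro integrable_continuous_real continuous_on_along_line assms)
  have "steklov v f z - c = integral {0..1} (\<lambda>t::real. f (z + of_real t * v) - c)"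
    unfolding steklov_def by (subst Henstock_Kurzweil_Integration.integral_diff) (auto intro: int)
  also have "norm \<dots> \<le> \<epsilon> * (1 - 0)"
    by (intro integral_bound continuous_intros continuous_on_along_line assms) (auto intro: near)
  finally show ?thesis by simp
qed

lemma moving_integral_has_vector_derivative:
  fixes g :: "real \<Rightarrow> complex"
  assumes g: "continuous_on UNIV g"
  shows "((\<lambda>y. integral {0..1} (\<lambda>t. g (y + t))) has_vector_derivative g (x + 1) - g x) (at x)"
proof -
  \<comment> \<open>An antiderivative based at \<open>x - 2\<close>, so that all arguments used for
    \<open>y\<close> near \<open>x\<close> are interior to its interval.\<close>
  define G where "G u = integral {x - 2..u} g" for u
  have G: "(G has_vector_derivative g u) (at u)" if "u \<in> {x - 2<..<x + 3}" for u
  proof -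
    have "(G has_vector_derivative g u) (at u within {x - 2..x + 3})"
      unfolding G_def using that
      by (intro integral_has_vector_derivative continuous_on_subset[OF g]) auto
    then show ?thesis using that by (simp add: at_within_Icc_at)
  qed
  have G_shift: "((\<lambda>t. G (t + c)) has_vector_derivative g (u + c)) (at u)"
    if "u + c \<in> {x - 2<..<x + 3}" for u c
  proof -
    have "((\<lambda>t. t + c) has_vector_derivative 1) (at u)"
      by (auto intro!: derivative_eq_intros)
    from vector_diff_chain_at[OF this G[OF that]] show ?thesis by (simp add: o_def)
  qed
  have eq: "G (y + 1) - G y = integral {0..1} (\<lambda>t. g (y + t))" if "y \<in> {x - 1<..<x + 1}" for y
  proof -
    have "((\<lambda>t. g (t + y)) has_integral G (1 + y) - G (0 + y)) {0..1}"
      by (rule fundamental_theorem_of_calculus)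
         (use that in \<open>auto intro!: has_vector_derivative_at_within G_shift\<close>)
    then show ?thesis by (simp add: integral_unique add.commute)
  qed
  have "((\<lambda>y. G (y + 1) - G y) has_vector_derivative g (x + 1) - g x) (at x)"
    using G_shift[of x 1] G[of x] by (intro derivative_intros) auto
  then show ?thesis
    by (rule has_vector_derivative_transform_within_open[where S = "{x - 1<..<x + 1}"]) (auto simp: eq)
qed

lemma steklov_has_vector_derivative:
  assumes "continuous_on UNIV f"
  shows "((\<lambda>x. steklov v f (z + of_real x * v)) has_vector_derivative
    f (z + of_real (x + 1) * v) - f (z + of_real x * v)) (at x)"
proof -
  have "steklov v f (z + of_real x * v) = integral {0..1} (\<lambda>t. f (z + of_real (x + t) * v))" for x
    by (simp add: steklov_def algebra_simps)
  then show ?thesis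
    using moving_integral_has_vector_derivative[OF continuous_on_along_line[OF assms, of UNIV z v]]
    by simp
qed

text \<open>Fubini. Either of the two directions can thus be made the outermost mean, the one that
  is differentiated explicitly.\<close>

lemma steklov_commute:
  assumes "continuous_on UNIV f"
  shows "steklov v (steklov w f) = steklov w (steklov v f)"
proof
  fix z
  have "continuous_on (cbox (0, 0) (1, 1)) (\<lambda>(s::real, t::real). f (z + of_real s * v + of_real t * w))"
    unfolding case_prod_beta by (rule continuous_on_compose2[OF assms]) (auto intro!: continuous_intros)
  from integral_swap_continuous[OF this] show "steklov v (steklov w f) z = steklov w (steklov v f) z"
    by (simp add: steklov_def add_ac)
qed

text \<open>The criterion that one continuous partial derivative beside an existing one gives total
  differentiability, applied on \<open>real \<times> real\<close> and pulled back along
  \<open>w \<mapsto> (Re w, Im w)\<close>.\<close>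

lemma has_derivative_of_partials:
  fixes F :: "complex \<Rightarrow> complex"
  assumes x: "\<And>z. ((\<lambda>x. F (z + of_real x)) has_vector_derivative Dx z) (at 0)"
    and y: "\<And>z. ((\<lambda>y. F (z + of_real y * \<i>)) has_vector_derivative Dy z) (at 0)"
    and cont: "continuous_on UNIV Dy"
  shows "(F has_derivative (\<lambda>h. Dx z * of_real (Re h) + Dy z * of_real (Im h))) (at z)"
proof -
  have shift: "((\<lambda>x. g x) has_vector_derivative D) (at a)"
    if "((\<lambda>x. g (a + x)) has_vector_derivative D) (at 0)" for g :: "real \<Rightarrow> complex" and D a
  proof -
    have "((\<lambda>x. x - a) has_vector_derivative 1) (at a)"
      by (auto intro!: derivative_eq_intros)
    from vector_diff_chain_at[OF this, of "\<lambda>x. g (a + x)" D] that show ?thesis by (simp add: o_def)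
  qed
  have px: "((\<lambda>x. F (Complex x b)) has_vector_derivative Dx (Complex a b)) (at a)" for a b
  proof (rule shift)
    have "Complex a b + of_real x = Complex (a + x) b" for x by (simp add: complex_eq_iff)
    then show "((\<lambda>x. F (Complex (a + x) b)) has_vector_derivative Dx (Complex a b)) (at 0)"
      using x[of "Complex a b"] by simp
  qed
  have py: "((\<lambda>y. F (Complex a y)) has_vector_derivative Dy (Complex a b)) (at b)" for a b
  proof (rule shift)
    have "Complex a b + of_real y * \<i> = Complex a (b + y)" for y by (simp add: complex_eq_iff)
    then show "((\<lambda>y. F (Complex a (b + y))) has_vector_derivative Dy (Complex a b)) (at 0)"
      using y[of "Complex a b"] by simp
  qed
  have "((\<lambda>(x, y). F (Complex x y)) has_derivative
      (\<lambda>(tx, ty). tx *\<^sub>R Dx z + blinfun_scaleR_left (Dy (Complex (Re z) (Im z))) ty)) (at (Re z, Im z) within UNIV \<times> UNIV)"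
  proof (rule has_derivative_partialsI)
    show "((\<lambda>x. F (Complex x (Im z))) has_derivative (\<lambda>tx. tx *\<^sub>R Dx z)) (at (Re z) within UNIV)"
      using px[of "Im z" "Re z"] by (simp add: has_vector_derivative_def)
    show "((\<lambda>y. F (Complex x y)) has_derivative blinfun_apply (blinfun_scaleR_left (Dy (Complex x y)))) (at y within UNIV)" for x y
      using py[of x y] by (simp add: has_vector_derivative_def)
    have "continuous_on UNIV (\<lambda>p::real \<times> real. Dy (Complex (fst p) (snd p)))"
      by (rule continuous_on_compose2[OF cont]) (auto simp: Complex_eq intro!: continuous_intros)
    then have "continuous_on UNIV (\<lambda>p::real \<times> real. blinfun_scaleR_left (Dy (Complex (fst p) (snd p))))"
      by (rule bounded_linear.continuous_on[OF bounded_linear_blinfun_scaleR_left])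
    then show "continuous (at (Re z, Im z) within UNIV \<times> UNIV) (\<lambda>(x, y). blinfun_scaleR_left (Dy (Complex x y)))"
      by (simp add: case_prod_beta' continuous_on_eq_continuous_at)
  qed auto
  then have "((\<lambda>p. F (Complex (fst p) (snd p))) has_derivative
      (\<lambda>t. fst t *\<^sub>R Dx z + snd t *\<^sub>R Dy z)) (at (Re z, Im z))"
    by (simp add: case_prod_beta')
  moreover have "((\<lambda>w. (Re w, Im w)) has_derivative (\<lambda>h. (Re h, Im h))) (at z)"
    by (auto intro!: derivative_eq_intros)
  ultimately have "((\<lambda>p. F (Complex (fst p) (snd p))) \<circ> (\<lambda>w. (Re w, Im w)) has_derivative
      (\<lambda>t. fst t *\<^sub>R Dx z + snd t *\<^sub>R Dy z) \<circ> (\<lambda>h. (Re h, Im h))) (at z)"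
    by (intro diff_chain_at) auto
  then show ?thesis by (simp add: o_def scaleR_conv_of_real mult.commute)
qed

text \<open>Written with either direction outermost, the double mean has as partial derivative a
  difference of the single mean in the other direction, which is continuous.\<close>

lemma steklov_1_i_has_derivative:
  assumes f: "continuous_on UNIV f"
  defines "F \<equiv> steklov 1 (steklov \<i> f)"
  obtains Dx Dy where "(F has_derivative (\<lambda>h. Dx * of_real (Re h) + Dy * of_real (Im h))) (at z)"
proof
  note cont = continuous_on_steklov[OF f]
  show "(F has_derivative (\<lambda>h. (steklov \<i> f (z + 1) - steklov \<i> f z) * of_real (Re h) +
      (steklov 1 f (z + \<i>) - steklov 1 f z) * of_real (Im h))) (at z)"
  proof (rule has_derivative_of_partials)
    show "((\<lambda>x. F (z + of_real x)) has_vector_derivative steklov \<i> f (z + 1) - steklov \<i> f z) (at 0)" for z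
      using steklov_has_vector_derivative[OF cont, of 1 \<i> z 0] by (simp add: F_def)
    show "((\<lambda>y. F (z + of_real y * \<i>)) has_vector_derivative steklov 1 f (z + \<i>) - steklov 1 f z) (at 0)" for z
      using steklov_has_vector_derivative[OF cont, of \<i> 1 z 0] by (simp add: F_def steklov_commute[OF f, of 1])
    show "continuous_on UNIV (\<lambda>z. steklov 1 f (z + \<i>) - steklov 1 f z)"
      by (intro continuous_intros continuous_on_compose2[OF cont] ) auto
  qed
qed

text \<open>Riemann sums of a Steklov mean are finite combinations of translates; this error bound
  will put the mean into the closed span. The induction runs over the cells, each contributing at
  most \<open>\<epsilon> / N\<close>.\<close>

lemma left_riemann_sum_bound:
  fixes g :: "real \<Rightarrow> complex"
  assumes g: "continuous_on {0..1} g" and N: "N > 0"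
    and osc: "\<And>s t. 0 \<le> s \<Longrightarrow> s \<le> t \<Longrightarrow> t \<le> 1 \<Longrightarrow> t - s \<le> 1 / real N \<Longrightarrow> norm (g t - g s) \<le> \<epsilon>"
  shows "norm (integral {0..1} g - (\<Sum>k<N. g (real k / real N)) / of_nat N) \<le> \<epsilon>"
proof -
  have "norm (integral {0..real m / real N} g - (\<Sum>k<m. g (real k / real N)) / of_nat N) \<le> real m * (\<epsilon> / real N)"
    if "m \<le> N" for m
    using that
  proof (induction m)
    case 0
    then show ?case by simp
  next
    case (Suc m)
    define a b where "a = real m / real N" and "b = real (Suc m) / real N"
    have ab: "0 \<le> a" "a \<le> b" "b \<le> 1" "b - a = 1 / real N"
      using Suc.prems N by (auto simp: a_def b_def field_simps)
    have gab: "continuous_on {a..b} g"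
      using ab by (intro continuous_on_subset[OF g]) auto
    have "norm (integral {a..b} (\<lambda>t. g t - g a)) \<le> \<epsilon> * (b - a)"
      using ab gab by (intro integral_bound continuous_intros osc) auto
    also have "integral {a..b} (\<lambda>t. g t - g a) = integral {a..b} g - g a / of_nat N"
      using ab gab
      by (subst Henstock_Kurzweil_Integration.integral_diff)
         (auto intro: integrable_continuous_real simp: scaleR_conv_of_real)
    finally have 1: "norm (integral {a..b} g - g a / of_nat N) \<le> \<epsilon> / real N"
      using ab by simp
    have "integral {0..a} g + integral {a..b} g = integral {0..b} g"
      using ab by (intro Henstock_Kurzweil_Integration.integral_combine integrable_continuous_real
          continuous_on_subset[OF g]) auto
    then have "integral {0..b} g - (\<Sum>k<Suc m. g (real k / real N)) / of_nat N =
        (integral {0..a} g - (\<Sum>k<m. g (real k / real N)) / of_nat N) + (integral {a..b} g - g a / of_nat N)"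
      by (simp add: add_divide_distrib a_def algebra_simps)
    also have "norm \<dots> \<le> real m * (\<epsilon> / real N) + \<epsilon> / real N"
      using Suc 1 by (intro norm_triangle_le add_mono) (auto simp: a_def)
    finally show ?case by (simp add: b_def algebra_simps add_divide_distrib)
  qed
  from this[of N] N show ?thesis by simp
qed

section \<open>The closed span of ridge functions\<close>

text \<open>Generated step by step instead of as a linear span, since evaluation in the registers
  follows the same four constructors.\<close>

inductive_set ridge_span :: "(complex \<Rightarrow> complex) \<Rightarrow> (complex \<Rightarrow> complex) set" for \<sigma> where
  const: "(\<lambda>_. c) \<in> ridge_span \<sigma>"
| ridge: "(\<lambda>w. \<sigma> (a * w + b)) \<in> ridge_span \<sigma>"
| add: "f \<in> ridge_span \<sigma> \<Longrightarrow> g \<in> ridge_span \<sigma> \<Longrightarrow> (\<lambda>w. f w + g w) \<in> ridge_span \<sigma>"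
| scale: "f \<in> ridge_span \<sigma> \<Longrightarrow> (\<lambda>w. c * f w) \<in> ridge_span \<sigma>"

lemma ridge_span_affine: "f \<in> ridge_span \<sigma> \<Longrightarrow> (\<lambda>w. f (a * w + b)) \<in> ridge_span \<sigma>"
proof (induction rule: ridge_span.induct)
  case (ridge a' b')
  have "(\<lambda>w. \<sigma> (a' * a * w + (a' * b + b'))) \<in> ridge_span \<sigma>" by (rule ridge_span.ridge)
  then show ?case by (simp add: algebra_simps)
qed (auto intro: ridge_span.intros)

lemma ridge_span_continuous:
  assumes "continuous_on UNIV \<sigma>" "f \<in> ridge_span \<sigma>"
  shows "continuous_on S f"
  using assms(2)
proof (induction rule: ridge_span.induct)
  case (ridge a b)
  show ?case by (rule continuous_on_compose2[OF assms(1)]) (auto intro!: continuous_intros)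
qed (auto intro: continuous_intros)

locale continuous_ridge =
  fixes \<sigma> :: "complex \<Rightarrow> complex"
  assumes cont: "continuous_on UNIV \<sigma>"
begin

definition closed_span :: "(complex \<Rightarrow> complex) set" where
  "closed_span = compact_closure (ridge_span \<sigma>)"

lemma closed_span_continuous: "f \<in> closed_span \<Longrightarrow> continuous_on S f"
  unfolding closed_span_def by (rule compact_closure_continuous)

lemma closed_span_incl: "f \<in> ridge_span \<sigma> \<Longrightarrow> f \<in> closed_span"
  unfolding closed_span_def by (intro compact_closure_incl ridge_span_continuous[OF cont])

lemma closed_span_const: "(\<lambda>_. c) \<in> closed_span"
  by (intro closed_span_incl ridge_span.const)

lemma closed_span_limit:
  assumes "continuous_on UNIV f"
    and "\<And>R \<epsilon>. \<epsilon> > 0 \<Longrightarrow> \<exists>g\<in>closed_span. \<forall>z. norm z \<le> R \<longrightarrow> norm (g z - f z) < \<epsilon>"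
  shows "f \<in> closed_span"
  unfolding closed_span_def
proof (rule compact_closure_limit[OF assms(1)])
  fix K :: "complex set" and \<epsilon> :: real assume "compact K" "\<epsilon> > 0"
  then obtain R where "\<And>z. z \<in> K \<Longrightarrow> norm z \<le> R"
    using compact_imp_bounded[of K] by (auto simp: bounded_iff)
  then show "\<exists>g\<in>compact_closure (ridge_span \<sigma>). \<forall>z\<in>K. norm (g z - f z) < \<epsilon>"
    using assms(2)[OF \<open>\<epsilon> > 0\<close>, of R] unfolding closed_span_def by meson
qed

lemma closed_span_scale:
  assumes f: "f \<in> closed_span"
  shows "(\<lambda>w. c * f w) \<in> closed_span"
  unfolding closed_span_def
proof (rule compact_closureI)
  show "continuous_on UNIV (\<lambda>w. c * f w)"
    by (intro continuous_intros closed_span_continuous[OF f])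
  fix K :: "complex set" and \<epsilon> :: real assume K: "compact K" "\<epsilon> > 0"
  have "\<epsilon> / (norm c + 1) > 0" using K by (simp add: add_nonneg_pos)
  then obtain g where g: "g \<in> ridge_span \<sigma>" "\<And>z. z \<in> K \<Longrightarrow> norm (g z - f z) < \<epsilon> / (norm c + 1)"
    using compact_closureE[OF f[unfolded closed_span_def] K(1)] by blast
  have "norm (c * g z - c * f z) < \<epsilon>" if "z \<in> K" for z
  proof -
    have "norm (c * g z - c * f z) = norm c * norm (g z - f z)"
      by (simp flip: norm_mult add: right_diff_distrib)
    also have "\<dots> \<le> (norm c + 1) * norm (g z - f z)" by (simp add: mult_right_mono)
    also have "\<dots> < \<epsilon>"
      using g(2)[OF that] by (simp add: pos_less_divide_eq add_nonneg_pos mult.commute)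
    finally show ?thesis .
  qed
  then show "\<exists>g\<in>ridge_span \<sigma>. \<forall>z\<in>K. norm (g z - c * f z) < \<epsilon>"
    using ridge_span.scale[OF g(1)] by (intro bexI) auto
qed

lemma closed_span_add:
  assumes f: "f \<in> closed_span" and g: "g \<in> closed_span"
  shows "(\<lambda>w. f w + g w) \<in> closed_span"
  unfolding closed_span_def
proof (rule compact_closureI)
  show "continuous_on UNIV (\<lambda>w. f w + g w)"
    by (intro continuous_intros closed_span_continuous f g)
  fix K :: "complex set" and \<epsilon> :: real assume K: "compact K" "\<epsilon> > 0"
  then have "\<epsilon> / 2 > 0" by simp
  then obtain f' g' where f': "f' \<in> ridge_span \<sigma>" "\<And>z. z \<in> K \<Longrightarrow> norm (f' z - f z) < \<epsilon> / 2"
    and g': "g' \<in> ridge_span \<sigma>" "\<And>z. z \<in> K \<Longrightarrow> norm (g' z - g z) < \<epsilon> / 2"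
    using compact_closureE[OF f[unfolded closed_span_def] K(1)]
      compact_closureE[OF g[unfolded closed_span_def] K(1)] by metis
  have "norm ((f' z + g' z) - (f z + g z)) < \<epsilon>" if "z \<in> K" for z
    using norm_add_less[OF f'(2)[OF that] g'(2)[OF that]] by (simp add: algebra_simps)
  then show "\<exists>h\<in>ridge_span \<sigma>. \<forall>z\<in>K. norm (h z - (f z + g z)) < \<epsilon>"
    using ridge_span.add[OF f'(1) g'(1)] by (intro bexI) auto
qed

lemma closed_span_diff:
  assumes "f \<in> closed_span" "g \<in> closed_span"
  shows "(\<lambda>w. f w - g w) \<in> closed_span"
  using closed_span_add[OF assms(1) closed_span_scale[OF assms(2), of "-1"]] by simp

lemma closed_span_sum:
  "(\<And>k. k \<in> I \<Longrightarrow> f k \<in> closed_span) \<Longrightarrow> (\<lambda>w. \<Sum>k\<in>I. f k w) \<in> closed_span"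
  by (induction I rule: infinite_finite_induct) (auto intro: closed_span_const closed_span_add)

lemma closed_span_affine:
  assumes f: "f \<in> closed_span"
  shows "(\<lambda>w. f (a * w + b)) \<in> closed_span"
proof -
  have "(\<lambda>w. a * w + b) \<in> compact_closure {\<lambda>w. a * w + b}"
    by (intro compact_closure_incl continuous_intros) auto
  from compact_closure_compose[OF this f[unfolded closed_span_def], of "ridge_span \<sigma>"]
  show ?thesis
    by (simp add: closed_span_def o_def ridge_span_affine)
qed

lemma self_in_closed_span: "\<sigma> \<in> closed_span"
  using closed_span_incl[OF ridge_span.ridge[of \<sigma> 1 0]] by simp

lemma closed_span_steklov:
  assumes f: "f \<in> closed_span"
  shows "steklov v f \<in> closed_span"
proof (rule closed_span_limit)
  show "continuous_on UNIV (steklov v f)"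
    by (intro continuous_on_steklov closed_span_continuous f)
  fix R \<epsilon> :: real assume "\<epsilon> > 0"
  \<comment> \<open>Contains every segment from \<open>z\<close> to \<open>z + v\<close> with
    \<open>norm z \<le> R\<close>.\<close>
  define B where "B = cball (0::complex) (R + norm v)"
  have "uniformly_continuous_on B f"
    unfolding B_def by (intro compact_uniformly_continuous closed_span_continuous f compact_cball)
  then obtain \<delta> where \<delta>: "\<delta> > 0"
      "\<And>x y. x \<in> B \<Longrightarrow> y \<in> B \<Longrightarrow> dist y x < \<delta> \<Longrightarrow> dist (f y) (f x) < \<epsilon> / 2"
    using \<open>\<epsilon> > 0\<close> unfolding uniformly_continuous_on_def by (metis half_gt_zero)
  obtain N :: nat where N: "N > 0" "norm v / \<delta> < real N"
    by (metis gr0I of_nat_0 of_nat_less_0_iff reals_Archimedean2 norm_ge_zero \<delta>(1) divide_nonneg_pos not_less)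
  define g where "g z = inverse (of_nat N) * (\<Sum>k<N. f (1 * z + of_real (real k / real N) * v))" for z
  have "g \<in> closed_span"
    unfolding g_def by (intro closed_span_scale closed_span_sum closed_span_affine f)
  moreover have "norm (g z - steklov v f z) < \<epsilon>" if z: "norm z \<le> R" for z
  proof -
    define h where "h t = f (z + of_real t * v)" for t :: real
    have inB: "z + of_real t * v \<in> B" if "0 \<le> t" "t \<le> 1" for t
    proof -
      have "norm (of_real t * v) \<le> norm v"
        using that by (simp add: norm_mult mult_left_le_one_le)
      then show ?thesis
        using z norm_triangle_ineq[of z "of_real t * v"] by (simp add: B_def)
    qed
    have "norm (integral {0..1} h - (\<Sum>k<N. h (real k / real N)) / of_nat N) \<le> \<epsilon> / 2"
    proof (rule left_riemann_sum_bound)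
      show "continuous_on {0..1} h"
        unfolding h_def by (intro continuous_on_along_line closed_span_continuous f)
      fix s t :: real assume st: "0 \<le> s" "s \<le> t" "t \<le> 1" "t - s \<le> 1 / real N"
      have "norm ((z + of_real t * v) - (z + of_real s * v)) = (t - s) * norm v"
        using st by (simp flip: left_diff_distrib of_real_diff add: norm_mult)
      also have "\<dots> \<le> 1 / real N * norm v" using st by (intro mult_right_mono) auto
      also have "\<dots> < \<delta>" using N \<delta>(1) by (simp add: field_simps)
      finally have "dist (z + of_real t * v) (z + of_real s * v) < \<delta>" by (simp add: dist_norm)
      then show "norm (h t - h s) \<le> \<epsilon> / 2"
        using \<delta>(2)[OF inB[of s] inB[of t]] st by (simp add: h_def dist_norm)
    qed (rule N)
    moreover have "g z = (\<Sum>k<N. h (real k / real N)) / of_nat N"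
      by (simp add: g_def h_def divide_inverse mult.commute)
    moreover have "steklov v f z = integral {0..1} h"
      by (simp add: steklov_def h_def[abs_def])
    ultimately have "norm (g z - steklov v f z) \<le> \<epsilon> / 2"
      by (simp only: norm_minus_commute)
    then show ?thesis using \<open>\<epsilon> > 0\<close> by linarith
  qed
  ultimately show "\<exists>g\<in>closed_span. \<forall>z. norm z \<le> R \<longrightarrow> norm (g z - steklov v f z) < \<epsilon>" by blast
qed

text \<open>Difference quotients \<open>w \<mapsto> (f (p + \<eta> w) - f p) / \<eta>\<close> stay
  in the span, because affine reparametrisation does, and tend to the derivative uniformly for
  bounded \<open>w\<close>.\<close>

lemma closed_span_derivative:
  assumes f: "f \<in> closed_span" and L: "(f has_derivative L) (at p)"
  shows "L \<in> closed_span"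
proof (rule closed_span_limit)
  have bl: "bounded_linear L" using L by (rule has_derivative_bounded_linear)
  then show "continuous_on UNIV L" by (rule linear_continuous_on)
  fix R \<epsilon> :: real assume "\<epsilon> > 0"
  define e where "e = \<epsilon> / (\<bar>R\<bar> + 1)"
  have "e > 0" using \<open>\<epsilon> > 0\<close> by (simp add: e_def)
  then obtain d where d: "d > 0"
      "\<And>y. norm (y - p) < d \<Longrightarrow> norm (f y - f p - L (y - p)) \<le> e * norm (y - p)"
    using L unfolding has_derivative_within_alt by (metis UNIV_I)
  define \<eta> where "\<eta> = d / (\<bar>R\<bar> + 1)"
  have \<eta>: "\<eta> > 0" using d(1) by (simp add: \<eta>_def)
  define g where "g w = inverse (of_real \<eta>) * (f (of_real \<eta> * w + p) - f p)" for w
  have "g \<in> closed_span"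
    unfolding g_def
    by (rule closed_span_scale[OF closed_span_diff[OF closed_span_affine[OF f] closed_span_const]])
  moreover have "norm (g w - L w) < \<epsilon>" if w: "norm w \<le> R" for w
  proof -
    have "\<eta> * norm w \<le> \<eta> * \<bar>R\<bar>" using w \<eta> by simp
    also have "\<dots> < d" using d(1) by (simp add: \<eta>_def field_simps)
    finally have "norm (of_real \<eta> * w) < d" using \<eta> by (simp add: norm_mult)
    then have "norm (f (of_real \<eta> * w + p) - f p - L (of_real \<eta> * w)) \<le> e * norm (of_real \<eta> * w)"
      using d(2)[of "of_real \<eta> * w + p"] by simp
    moreover have "L (of_real \<eta> * w) = of_real \<eta> * L w"
      using linear_scale[OF bounded_linear.linear[OF bl], of \<eta> w] by (simp add: scaleR_conv_of_real)
    moreover have "f (of_real \<eta> * w + p) - f p - of_real \<eta> * L w = of_real \<eta> * (g w - L w)"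
      using \<eta> by (simp add: g_def right_diff_distrib flip: mult.assoc)
    ultimately have "\<eta> * norm (g w - L w) \<le> \<eta> * (e * norm w)"
      using \<eta> by (simp add: norm_mult mult_ac)
    then have "norm (g w - L w) \<le> e * norm w" using \<eta> by simp
    also have "\<dots> \<le> e * \<bar>R\<bar>" using w \<open>e > 0\<close> by simp
    also have "\<dots> < \<epsilon>" using \<open>\<epsilon> > 0\<close> by (simp add: e_def field_simps)
    finally show ?thesis .
  qed
  ultimately show "\<exists>g\<in>closed_span. \<forall>z. norm z \<le> R \<longrightarrow> norm (g z - L z) < \<epsilon>" by blast
qed

end

text \<open>Cauchy's functional equation. Instead of passing through rational multiples: additivity
  turns the moving integral of \<open>g\<close> into \<open>g\<close> plus a constant, and the
  moving integral has derivative \<open>g (y + 1) - g y = g 1\<close>, so \<open>g\<close> is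
  linear.\<close>

lemma continuous_additive_imp_linear:
  fixes L :: "complex \<Rightarrow> complex"
  assumes cont: "continuous_on UNIV L" and add: "\<And>x y. L (x + y) = L x + L y"
  shows "linear L"
proof (rule linearI)
  fix r :: real and x
  have L0: "L 0 = 0" using add[of 0 0] by simp
  define g where "g t = L (0 + of_real t * x)" for t :: real
  have g: "continuous_on UNIV g" unfolding g_def by (rule continuous_on_along_line[OF cont])
  have g_add: "g (s + t) = g s + g t" for s t by (simp add: g_def distrib_right add)
  have int: "integral {0..1} (\<lambda>t. g (y + t)) = g y + integral {0..1} g" for y
    unfolding g_add
    by (subst Henstock_Kurzweil_Integration.integral_add)
       (auto intro!: integrable_continuous_real continuous_on_subset[OF g])
  have "((\<lambda>y. g y + integral {0..1} g - of_real y * g 1) has_vector_derivative 0) (at y within UNIV)" for y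
  proof -
    have "((\<lambda>y. g y + integral {0..1} g) has_vector_derivative g 1) (at y)"
      using moving_integral_has_vector_derivative[OF g, of y] unfolding int by (simp add: g_add)
    moreover have "((\<lambda>y. of_real y * g 1) has_vector_derivative g 1) (at y)"
      by (auto simp: scaleR_conv_of_real[symmetric] intro!: derivative_eq_intros)
    ultimately have "((\<lambda>y. g y + integral {0..1} g - of_real y * g 1) has_vector_derivative g 1 - g 1) (at y)"
      by (rule has_vector_derivative_diff)
    then show ?thesis by simp
  qed
  from has_vector_derivative_zero_constant[of UNIV, OF convex_UNIV this]
  obtain c where c: "\<And>y. g y + integral {0..1} g - of_real y * g 1 = c" by auto
  have "g r + integral {0..1} g - of_real r * g 1 = g 0 + integral {0..1} g - of_real 0 * g 1"
    unfolding c ..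
  then have "g r - of_real r * g 1 = g 0" by (simp add: diff_add_eq[symmetric])
  then show "L (r *\<^sub>R x) = r *\<^sub>R L x" by (simp add: g_def L0 scaleR_conv_of_real)
qed (rule add)

lemma R_affine_if_second_differences_vanish:
  assumes cont: "continuous_on UNIV \<sigma>" and zero: "\<And>p v. \<sigma> (p + 2 * v) - 2 * \<sigma> (p + v) + \<sigma> p = 0"
  shows "R_affine \<sigma>"
proof -
  define L where "L z = \<sigma> z - \<sigma> 0" for z
  have mid: "\<sigma> x + \<sigma> y = 2 * \<sigma> ((x + y) / 2)" for x y
  proof -
    have "x + 2 * ((y - x) / 2) = y" "x + (y - x) / 2 = (x + y) / 2" by (simp_all add: field_simps)
    with zero[of x "(y - x) / 2"] show ?thesis by (simp add: algebra_simps)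
  qed
  \<comment> \<open>The pairs \<open>x, y\<close> and \<open>x + y, 0\<close> have the same
    midpoint.\<close>
  have "L (x + y) = L x + L y" for x y
    using mid[of x y] mid[of "x + y" 0] by (simp add: L_def algebra_simps)
  then have "linear L"
    by (intro continuous_additive_imp_linear) (auto simp: L_def intro!: continuous_intros cont)
  then show ?thesis unfolding R_affine_def by (intro exI[of _ L] exI[of _ "\<sigma> 0"]) (simp add: L_def)
qed

text \<open>Second-order Taylor expansion in Peano form, with the first derivative differentiable at
  one point only. The first-order terms cancel by symmetry, the derivative of the remainder is o(t),
  and the mean value inequality gives o(t^2).\<close>

lemma symmetric_second_difference:
  fixes u w :: "real \<Rightarrow> complex"
  assumes u: "\<And>x. (u has_vector_derivative w x) (at x)" and w: "(w has_vector_derivative D) (at 0)"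
    and \<epsilon>: "\<epsilon> > 0"
  obtains \<delta> where "\<delta> > 0"
    "\<And>t. \<bar>t\<bar> < \<delta> \<Longrightarrow> norm (u t + u (- t) - 2 * u 0 - D * of_real (t\<^sup>2)) \<le> \<epsilon> * t\<^sup>2"
proof -
  have "\<epsilon> / 2 > 0" using \<epsilon> by simp
  then obtain \<delta> where \<delta>: "\<delta> > 0"
      "\<And>s. \<bar>s\<bar> < \<delta> \<Longrightarrow> norm (w s - w 0 - s *\<^sub>R D) \<le> \<epsilon> / 2 * \<bar>s\<bar>"
    using w unfolding has_vector_derivative_def has_derivative_within_alt real_norm_def
    by (metis UNIV_I diff_zero)
  define q where "q t = u t + u (- t) - 2 * u 0 - D * of_real (t\<^sup>2)" for t
  define q' where "q' t = w t - w (- t) - 2 * t *\<^sub>R D" for t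
  have u_neg: "((\<lambda>t. u (- t)) has_vector_derivative - w (- t)) (at t)" for t
  proof -
    have "(uminus has_vector_derivative -1) (at t)" by (auto intro!: derivative_eq_intros)
    from vector_diff_chain_at[OF this u] show ?thesis by (simp add: o_def)
  qed
  have q: "(q has_vector_derivative q' t) (at t)" for t
    unfolding q_def q'_def
    by (rule has_vector_derivative_eq_rhs, (rule derivative_intros u u_neg has_vector_derivative_of_real)+)
       (auto simp: scaleR_conv_of_real)
  have "norm (q t) \<le> \<epsilon> * t\<^sup>2" if t: "\<bar>t\<bar> < \<delta>" for t
  proof -
    have q': "norm (q' s) \<le> \<epsilon> * \<bar>s\<bar>" if "\<bar>s\<bar> < \<delta>" for s
    proof -
      have "q' s = (w s - w 0 - s *\<^sub>R D) - (w (- s) - w 0 - (- s) *\<^sub>R D)"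
        by (simp add: q'_def scaleR_conv_of_real algebra_simps)
      also have "norm \<dots> \<le> \<epsilon> / 2 * \<bar>s\<bar> + \<epsilon> / 2 * \<bar>- s\<bar>"
        using that by (intro norm_triangle_le_diff add_mono \<delta>) auto
      finally show ?thesis by simp
    qed
    have "norm (q t - q 0 - (t - 0) *\<^sub>R q' 0) \<le> norm (t - 0) * (\<epsilon> * \<bar>t\<bar>)"
    proof (rule vector_differentiable_bound_linearization)
      show "(q has_vector_derivative q' s) (at s within closed_segment 0 t)" for s
        by (rule has_vector_derivative_at_within[OF q])
      fix s assume "s \<in> closed_segment 0 t"
      then have s: "\<bar>s\<bar> \<le> \<bar>t\<bar>" by (auto simp: closed_segment_eq_real_ivl split: if_splits)
      have "norm (q' s) \<le> \<epsilon> * \<bar>s\<bar>" using s t by (intro q') auto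
      also have "\<dots> \<le> \<epsilon> * \<bar>t\<bar>" using s \<epsilon> by simp
      finally show "norm (q' s - q' 0) \<le> \<epsilon> * \<bar>t\<bar>" by (simp add: q'_def)
    qed auto
    moreover have "q 0 = 0" "q' 0 = 0" by (simp_all add: q_def q'_def)
    moreover have "\<bar>t\<bar> * (\<epsilon> * \<bar>t\<bar>) = \<epsilon> * t\<^sup>2" by (simp add: power2_eq_square)
    ultimately show ?thesis by simp
  qed
  with \<delta>(1) show ?thesis using that unfolding q_def by blast
qed

section \<open>Identity, conjugation and real squares in the closed span\<close>

context continuous_ridge
begin

text \<open>\<open>Dx - \<i> * Dy\<close> and \<open>Dx + \<i> * Dy\<close> are twice the Wirtinger
  derivatives, that is, the coefficients of \<open>w\<close> and \<open>cnj w\<close> in twice the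
  map; combining its values at \<open>w\<close> and \<open>\<i> * w\<close> isolates either
  part.\<close>

lemma closed_span_wirtinger:
  assumes L: "(\<lambda>h. Dx * of_real (Re h) + Dy * of_real (Im h)) \<in> closed_span"
  shows "Dx - \<i> * Dy \<noteq> 0 \<Longrightarrow> (\<lambda>w. w) \<in> closed_span"
    and "Dx + \<i> * Dy \<noteq> 0 \<Longrightarrow> cnj \<in> closed_span"
proof -
  define L where "L h = Dx * of_real (Re h) + Dy * of_real (Im h)" for h
  have comb: "(\<lambda>w. inverse \<gamma> * (L (1 * w + 0) + s * L (\<i> * w + 0))) \<in> closed_span" for \<gamma> s
    using assms unfolding L_def[symmetric, abs_def]
    by (intro closed_span_scale closed_span_add closed_span_affine)
  {
    assume nz: "Dx - \<i> * Dy \<noteq> 0"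
    have "L w + - \<i> * L (\<i> * w) = (Dx - \<i> * Dy) * w" for w
      by (simp add: L_def complex_eq_iff algebra_simps)
    then have "inverse (Dx - \<i> * Dy) * (L (1 * w + 0) + - \<i> * L (\<i> * w + 0)) = w" for w
      using nz by (simp flip: mult.assoc)
    with comb[of "Dx - \<i> * Dy" "- \<i>"] show "(\<lambda>w. w) \<in> closed_span" by simp
  next
    assume nz: "Dx + \<i> * Dy \<noteq> 0"
    have "L w + \<i> * L (\<i> * w) = (Dx + \<i> * Dy) * cnj w" for w
      by (simp add: L_def complex_eq_iff algebra_simps)
    then have "inverse (Dx + \<i> * Dy) * (L (1 * w + 0) + \<i> * L (\<i> * w + 0)) = cnj w" for w
      using nz by (simp flip: mult.assoc)
    with comb[of "Dx + \<i> * Dy" \<i>] show "cnj \<in> closed_span" by simp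
  }
qed

definition smoothed :: "nat \<Rightarrow> complex \<Rightarrow> complex" where
  "smoothed n = steklov 1 (steklov \<i> (\<lambda>w. \<sigma> (inverse (of_nat (Suc n)) * w + 0)))"

text \<open>\<open>smoothed n (Suc n * z)\<close> is the mean of \<open>\<sigma>\<close> over the square of side \<open>1 / Suc n\<close> with corner \<open>z\<close>.\<close>

lemma smoothed_has_derivative:
  obtains Dx Dy where "(smoothed n has_derivative (\<lambda>h. Dx * of_real (Re h) + Dy * of_real (Im h))) (at z)"
    "(\<lambda>h. Dx * of_real (Re h) + Dy * of_real (Im h)) \<in> closed_span"
proof -
  have mem: "(\<lambda>w. \<sigma> (inverse (of_nat (Suc n)) * w + 0)) \<in> closed_span"
    by (rule closed_span_affine[OF self_in_closed_span])
  then obtain Dx Dy where D: "(smoothed n has_derivative (\<lambda>h. Dx * of_real (Re h) + Dy * of_real (Im h))) (at z)"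
    unfolding smoothed_def using steklov_1_i_has_derivative[OF closed_span_continuous] by blast
  moreover have "smoothed n \<in> closed_span"
    unfolding smoothed_def by (intro closed_span_steklov mem)
  ultimately show ?thesis using that closed_span_derivative by blast
qed

lemma smoothed_uniform_limit:
  "uniform_limit (cball x 1) (\<lambda>n z. smoothed n (of_nat (Suc n) * z)) \<sigma> sequentially"
proof (rule uniform_limitI)
  fix \<epsilon> :: real assume "\<epsilon> > 0"
  \<comment> \<open>Radius 3: \<open>z\<close> lies within 1 of \<open>x\<close>, and the points of
    the averaged square lie within 2 of \<open>z\<close>.\<close>
  define B where "B = cball x 3"
  have "uniformly_continuous_on B \<sigma>"
    unfolding B_def by (intro compact_uniformly_continuous continuous_on_subset[OF cont] compact_cball) auto
  then obtain \<delta> where \<delta>: "\<delta> > 0"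
      "\<And>x y. x \<in> B \<Longrightarrow> y \<in> B \<Longrightarrow> dist y x < \<delta> \<Longrightarrow> dist (\<sigma> y) (\<sigma> x) < \<epsilon> / 2"
    using \<open>\<epsilon> > 0\<close> unfolding uniformly_continuous_on_def by (metis half_gt_zero)
  obtain N :: nat where N: "2 / \<delta> < real N" using reals_Archimedean2 by blast
  have "dist (smoothed n (of_nat (Suc n) * z)) (\<sigma> z) < \<epsilon>" if n: "n \<ge> N" and z: "z \<in> cball x 1" for n z
  proof -
    define f where "f w = \<sigma> (inverse (of_nat (Suc n)) * w + 0)" for w
    have f: "continuous_on UNIV f"
      unfolding f_def by (intro closed_span_continuous closed_span_affine self_in_closed_span)
    define m :: complex where "m = of_nat (Suc n)"
    have m: "m \<noteq> 0" "norm m = real (Suc n)"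
      unfolding m_def using of_nat_neq_0 norm_of_nat by blast+
    have "norm (f (m * z + of_real s * 1 + of_real t * \<i>) - \<sigma> z) \<le> \<epsilon> / 2"
      if st: "0 \<le> s" "s \<le> 1" "0 \<le> t" "t \<le> 1" for s t
    proof -
      \<comment> \<open>The offset in the enlarged square, scaled back; its norm is at most 2 / (n +
        1).\<close>
      define y where "y = (of_real s * 1 + of_real t * \<i>) / m"
      have "norm (of_real s * 1 + of_real t * \<i>) \<le> 2"
        using st by (intro norm_triangle_le) (simp add: norm_mult)
      then have y: "norm y \<le> 2 / real (Suc n)"
        unfolding y_def norm_divide m by (intro divide_right_mono) auto
      have "2 < \<delta> * real N" using N \<delta>(1) by (simp add: field_simps)
      also have "\<dots> \<le> \<delta> * real (Suc n)" using n \<delta>(1) by (intro mult_left_mono) auto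
      finally have "2 / real (Suc n) < \<delta>" by (simp add: divide_less_eq)
      moreover have "2 / real (Suc n) \<le> 2" by (simp add: field_simps)
      ultimately have y2: "norm y < \<delta>" "norm y \<le> 2" using y by linarith+
      have "z + y \<in> B" "z \<in> B"
        using z y2(2) norm_triangle_ineq4[of "x - z" y] by (auto simp: B_def dist_norm algebra_simps)
      then have "dist (\<sigma> (z + y)) (\<sigma> z) < \<epsilon> / 2" using y2(1) by (intro \<delta>(2)) (auto simp: dist_norm)
      moreover have "f (m * z + of_real s * 1 + of_real t * \<i>) = \<sigma> (z + y)"
      proof -
        have "(m * z + of_real s * 1 + of_real t * \<i>) / m = z + y"
          using m(1) by (simp add: y_def add_divide_distrib)
        moreover have "f w = \<sigma> (w / m)" for w
          by (simp add: f_def m_def divide_inverse mult.commute)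
        ultimately show ?thesis by simp
      qed
      ultimately show ?thesis by (simp add: dist_norm)
    qed
    then have "norm (smoothed n (m * z) - \<sigma> z) \<le> \<epsilon> / 2"
      unfolding smoothed_def f_def[symmetric, abs_def] by (intro steklov_near continuous_on_steklov f)
    then show ?thesis using \<open>\<epsilon> > 0\<close> by (simp add: dist_norm m_def)
  qed
  then show "\<forall>\<^sub>F n in sequentially. \<forall>z\<in>cball x 1. dist (smoothed n (of_nat (Suc n) * z)) (\<sigma> z) < \<epsilon>"
    by (intro eventually_sequentiallyI[of N]) auto
qed

text \<open>If \<open>cnj\<close> is missing, the conjugate-linear coefficient of every derivative
  of every \<open>smoothed n\<close> must vanish. These are the Cauchy-Riemann equations, so all
  \<open>smoothed n\<close> are entire, and so is the locally uniform limit \<sigma> of their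
  rescalings.\<close>

lemma cnj_in_closed_span:
  assumes "\<not> \<sigma> holomorphic_on UNIV"
  shows "cnj \<in> closed_span"
proof (rule ccontr)
  assume "cnj \<notin> closed_span"
  have "smoothed n holomorphic_on UNIV" for n
    unfolding holomorphic_on_def
  proof
    fix z
    obtain Dx Dy where D: "(smoothed n has_derivative (\<lambda>h. Dx * of_real (Re h) + Dy * of_real (Im h))) (at z)"
        "(\<lambda>h. Dx * of_real (Re h) + Dy * of_real (Im h)) \<in> closed_span"
      by (rule smoothed_has_derivative)
    then have "Dx + \<i> * Dy = 0" using closed_span_wirtinger(2) \<open>cnj \<notin> closed_span\<close> by blast
    then have "\<i> * (Dx + \<i> * Dy) = 0" by simp
    then have Dy: "Dy = \<i> * Dx" by (simp add: algebra_simps)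
    have "Dx * of_real (Re h) + Dy * of_real (Im h) = Dx * h" for h
      unfolding Dy by (simp add: complex_eq_iff algebra_simps)
    with D(1) show "smoothed n field_differentiable at z within UNIV"
      by (auto simp: field_differentiable_def has_field_derivative_def)
  qed
  then have "(\<lambda>z. smoothed n (of_nat (Suc n) * z)) holomorphic_on UNIV" for n
    by (rule holomorphic_on_compose_gen[unfolded o_def, rotated]) (auto intro!: holomorphic_intros)
  then have "\<sigma> holomorphic_on UNIV"
    by (rule holomorphic_uniform_sequence[OF open_UNIV]) (use smoothed_uniform_limit in \<open>auto intro!: exI[of _ 1]\<close>)
  then show False using assms by simp
qed

text \<open>The mirror image for the complex-linear coefficient; now the conjugates of the smoothed
  functions are entire.\<close>

lemma id_in_closed_span:
  assumes "\<not> antiholomorphic \<sigma>"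
  shows "(\<lambda>w. w) \<in> closed_span"
proof (rule ccontr)
  assume "(\<lambda>w. w) \<notin> closed_span"
  have "(\<lambda>z. cnj (smoothed n z)) holomorphic_on UNIV" for n
    unfolding holomorphic_on_def
  proof
    fix z
    obtain Dx Dy where D: "(smoothed n has_derivative (\<lambda>h. Dx * of_real (Re h) + Dy * of_real (Im h))) (at z)"
        "(\<lambda>h. Dx * of_real (Re h) + Dy * of_real (Im h)) \<in> closed_span"
      by (rule smoothed_has_derivative)
    then have "Dx - \<i> * Dy = 0" using closed_span_wirtinger(1) \<open>(\<lambda>w. w) \<notin> closed_span\<close> by blast
    then have "\<i> * (Dx - \<i> * Dy) = 0" by simp
    then have Dy: "Dy = - \<i> * Dx" by (simp add: algebra_simps eq_neg_iff_add_eq_0)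
    have "cnj (Dx * of_real (Re h) + Dy * of_real (Im h)) = cnj Dx * h" for h
      unfolding Dy by (simp add: complex_eq_iff algebra_simps)
    with bounded_linear.has_derivative[OF bounded_linear_cnj D(1)]
    show "(\<lambda>z. cnj (smoothed n z)) field_differentiable at z within UNIV"
      by (auto simp: field_differentiable_def has_field_derivative_def)
  qed
  then have hol: "(\<lambda>z. cnj (smoothed n (of_nat (Suc n) * z))) holomorphic_on UNIV" for n
    by (rule holomorphic_on_compose_gen[unfolded o_def, rotated]) (auto intro!: holomorphic_intros)
  have lim: "uniform_limit (cball x 1) (\<lambda>n z. cnj (smoothed n (of_nat (Suc n) * z))) (\<lambda>z. cnj (\<sigma> z)) sequentially" for x
    using smoothed_uniform_limit[of x] unfolding uniform_limit_iff dist_norm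
    by (simp flip: complex_cnj_diff)
  from hol have "(\<lambda>z. cnj (\<sigma> z)) holomorphic_on UNIV"
    by (rule holomorphic_uniform_sequence[OF open_UNIV]) (use lim in \<open>auto intro!: exI[of _ 1]\<close>)
  then show False using assms by (simp add: antiholomorphic_def)
qed

lemma Re_in_closed_span:
  assumes "\<not> \<sigma> holomorphic_on UNIV" "\<not> antiholomorphic \<sigma>"
  shows "(\<lambda>w. of_real (Re w)) \<in> closed_span"
proof -
  have "(\<lambda>w. (1/2) * (w + cnj w)) \<in> closed_span"
    by (intro closed_span_scale closed_span_add id_in_closed_span cnj_in_closed_span assms)
  then show ?thesis by (simp add: complex_add_cnj)
qed

text \<open>Smoothing twice along \<open>v\<close> makes the second derivative along
  \<open>v\<close> at \<open>p\<close> equal to the second difference of \<sigma> with step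
  \<open>v\<close>, and a function that is not real-affine has a nonzero one. Rescaled symmetric
  second differences then approach the square. Their arguments stay on the line through
  \<open>p\<close> in direction \<open>v\<close> only for real \<open>x\<close>, hence the
  restriction.\<close>

lemma real_square_approx:
  assumes "\<not> R_affine \<sigma>" "\<epsilon> > 0"
  shows "\<exists>g\<in>ridge_span \<sigma>. \<forall>x. \<bar>x\<bar> \<le> R \<longrightarrow> norm (g (of_real x) - of_real (x\<^sup>2)) < \<epsilon>"
proof -
  obtain p v where nz: "\<sigma> (p + 2 * v) - 2 * \<sigma> (p + v) + \<sigma> p \<noteq> 0"
    using R_affine_if_second_differences_vanish[OF cont] assms(1) by blast
  define D where "D = \<sigma> (p + 2 * v) - 2 * \<sigma> (p + v) + \<sigma> p"
  define F where "F = steklov v (steklov v \<sigma>)"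
  have F: "F \<in> closed_span" unfolding F_def by (intro closed_span_steklov self_in_closed_span)
  define u where "u x = F (p + of_real x * v)" for x :: real
  define w where "w x = steklov v \<sigma> (p + of_real (x + 1) * v) - steklov v \<sigma> (p + of_real x * v)" for x :: real
  have u: "(u has_vector_derivative w x) (at x)" for x
    unfolding u_def w_def F_def by (intro steklov_has_vector_derivative continuous_on_steklov cont)
  have w: "(w has_vector_derivative D) (at 0)"
  proof -
    have "(w has_vector_derivative (\<sigma> ((p + v) + of_real (0 + 1) * v) - \<sigma> ((p + v) + of_real 0 * v)) -
        (\<sigma> (p + of_real (0 + 1) * v) - \<sigma> (p + of_real 0 * v))) (at 0)"
      using has_vector_derivative_diff[OF steklov_has_vector_derivative[OF cont, of v "p + v" 0]
        steklov_has_vector_derivative[OF cont, of v p 0]]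
      by (simp add: w_def[abs_def] algebra_simps)
    then show ?thesis by (simp add: D_def algebra_simps)
  qed
  \<comment> \<open>Leaves an error of at most \<epsilon> / 4 for \<open>G\<close>, next to
    \<epsilon> / 2 for its approximation by \<open>g\<close>.\<close>
  define \<epsilon>' where "\<epsilon>' = norm D * (\<epsilon> / 4) / (R\<^sup>2 + 1)"
  have R1: "R\<^sup>2 + 1 > 0" by (simp add: add_nonneg_pos)
  then have "\<epsilon>' > 0" using nz assms(2) by (simp add: \<epsilon>'_def D_def)
  from symmetric_second_difference[OF u w this]
  obtain \<delta> where \<delta>: "\<delta> > 0"
    "\<And>t. \<bar>t\<bar> < \<delta> \<Longrightarrow> norm (u t + u (- t) - 2 * u 0 - D * of_real (t\<^sup>2)) \<le> \<epsilon>' * t\<^sup>2"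
    by blast
  define \<eta> where "\<eta> = \<delta> / (\<bar>R\<bar> + 1)"
  have \<eta>: "\<eta> > 0" using \<delta>(1) by (simp add: \<eta>_def)
  \<comment> \<open>The symmetric second difference quotient of \<open>u\<close>, with the real
    variable made complex so that it is a combination of \<open>F\<close> at affine
    arguments.\<close>
  define G where "G z = inverse (D * of_real (\<eta>\<^sup>2)) *
    ((F ((of_real \<eta> * v) * z + p) + F ((- of_real \<eta> * v) * z + p)) - 2 * u 0)" for z
  have "G \<in> closed_span"
    unfolding G_def
    by (rule closed_span_scale[OF closed_span_diff[OF
        closed_span_add[OF closed_span_affine[OF F] closed_span_affine[OF F]] closed_span_const]])
  then obtain g where g: "g \<in> ridge_span \<sigma>" "\<And>z. z \<in> cball 0 R \<Longrightarrow> norm (g z - G z) < \<epsilon> / 2"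
    using compact_closureE[of G "ridge_span \<sigma>" "cball 0 R" "\<epsilon> / 2"] assms(2)
    unfolding closed_span_def by auto
  have "norm (g (of_real x) - of_real (x\<^sup>2)) < \<epsilon>" if x: "\<bar>x\<bar> \<le> R" for x
  proof -
    have "\<eta> * \<bar>x\<bar> \<le> \<eta> * \<bar>R\<bar>" using x \<eta> by simp
    also have "\<dots> < \<delta>" using \<delta>(1) by (simp add: \<eta>_def field_simps)
    finally have "\<bar>\<eta> * x\<bar> < \<delta>" using \<eta> by (simp add: abs_mult)
    note \<delta>(2)[OF this]
    moreover have "u (\<eta> * x) + u (- (\<eta> * x)) - 2 * u 0 - D * of_real ((\<eta> * x)\<^sup>2) =
        (D * of_real (\<eta>\<^sup>2)) * (G (of_real x) - of_real (x\<^sup>2))"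
    proof -
      have "D * of_real (\<eta>\<^sup>2) \<noteq> 0" using nz \<eta> by (simp add: D_def)
      then have "(D * of_real (\<eta>\<^sup>2)) * G (of_real x) = u (\<eta> * x) + u (- (\<eta> * x)) - 2 * u 0"
        unfolding G_def by (simp only: mult.assoc[symmetric] right_inverse mult_1) (simp add: u_def mult_ac add_ac)
      then show ?thesis by (simp add: right_diff_distrib power_mult_distrib mult_ac)
    qed
    ultimately have "\<eta>\<^sup>2 * (norm D * norm (G (of_real x) - of_real (x\<^sup>2))) \<le> \<eta>\<^sup>2 * (\<epsilon>' * x\<^sup>2)"
      using \<eta> by (simp add: norm_mult power_mult_distrib mult_ac norm_power)
    then have "norm D * norm (G (of_real x) - of_real (x\<^sup>2)) \<le> \<epsilon>' * x\<^sup>2"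
      using \<eta> by simp
    also have "x\<^sup>2 \<le> R\<^sup>2 + 1"
      using power_mono[OF x, of 2] by simp
    then have "\<epsilon>' * x\<^sup>2 \<le> \<epsilon>' * (R\<^sup>2 + 1)" using \<open>\<epsilon>' > 0\<close> by simp
    also have "\<dots> = norm D * (\<epsilon> / 4)" using R1 unfolding \<epsilon>'_def by (intro nonzero_eq_divide_eq[THEN iffD1]) auto
    finally have "norm (G (of_real x) - of_real (x\<^sup>2)) \<le> \<epsilon> / 4"
      using nz by (simp add: D_def)
    moreover have "norm (g (of_real x) - G (of_real x)) < \<epsilon> / 2" using x by (intro g(2)) simp
    moreover have "norm (g (of_real x) - of_real (x\<^sup>2)) \<le>
        norm (g (of_real x) - G (of_real x)) + norm (G (of_real x) - of_real (x\<^sup>2))"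
      using norm_triangle_ineq[of "g (of_real x) - G (of_real x)" "G (of_real x) - of_real (x\<^sup>2)"] by simp
    ultimately show ?thesis using assms(2) by linarith
  qed
  with g(1) show ?thesis by blast
qed

end

section \<open>Computing with registers\<close>

text \<open>With \<open>y = x / N\<close> in [-1, 1] one has
  \<open>(1 - y\<^sup>2) * exp y \<le> 1 + y \<le> exp y\<close>. Taking N-th powers and applying
  Bernoulli's inequality to \<open>(1 - y\<^sup>2) ^ N\<close> gives the rate.\<close>

lemma exp_power_approx:
  fixes x R :: real
  assumes x: "\<bar>x\<bar> \<le> R" and N: "N > 0" "R \<le> real N"
  shows "\<bar>(1 + x / real N) ^ N - exp x\<bar> \<le> exp R * R\<^sup>2 / real N"
proof -
  define y where "y = x / real N"
  have y: "\<bar>y\<bar> \<le> 1" using x N by (simp add: y_def)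
  have exp_x: "exp y ^ N = exp x" using N by (simp add: y_def flip: exp_of_nat_mult)
  have "(1 + y) ^ N \<le> exp y ^ N" using y by (intro power_mono) auto
  then have upper: "(1 + y) ^ N \<le> exp x" by (simp only: exp_x)
  have "1 + y \<ge> (1 - y\<^sup>2) * exp y"
  proof -
    have "(1 + y) * exp (- y) \<ge> (1 + y) * (1 - y)"
      using y exp_ge_add_one_self[of "- y"] by (intro mult_left_mono) auto
    then have "(1 + y) * exp (- y) * exp y \<ge> (1 - y\<^sup>2) * exp y"
      by (intro mult_right_mono) (auto simp: power2_eq_square algebra_simps)
    then show ?thesis by (simp add: exp_minus_inverse mult.assoc flip: exp_add)
  qed
  then have "((1 - y\<^sup>2) * exp y) ^ N \<le> (1 + y) ^ N"
    using y by (intro power_mono mult_nonneg_nonneg) (auto simp: abs_square_le_1)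
  then have "(1 - y\<^sup>2) ^ N * exp x \<le> (1 + y) ^ N"
    by (simp only: power_mult_distrib exp_x)
  moreover have "1 + real N * - y\<^sup>2 \<le> (1 + - y\<^sup>2) ^ N"
    using y by (intro Bernoulli_inequality) (auto simp: abs_square_le_1)
  then have "(1 - real N * y\<^sup>2) * exp x \<le> (1 - y\<^sup>2) ^ N * exp x"
    by (intro mult_right_mono) auto
  ultimately have "exp x - (1 + y) ^ N \<le> real N * y\<^sup>2 * exp x"
    by (simp add: algebra_simps)
  also have "\<dots> = x\<^sup>2 / real N * exp x"
    using N by (simp add: y_def power2_eq_square)
  also have "\<dots> \<le> R\<^sup>2 / real N * exp R"
    using x N power_mono[OF x, of 2] by (intro mult_mono divide_right_mono) auto
  finally show ?thesis using upper by (simp add: y_def mult.commute)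
qed

lemma linear_vecI:
  fixes f :: "'a::field^'i::finite \<Rightarrow> 'a^'j::finite"
  assumes "\<And>x y. f (x + y) = f x + f y" "\<And>c x. f (c *s x) = c *s f x"
  shows "Vector_Spaces.linear (*s) (*s) f"
  using assms by (simp add: Vector_Spaces.linear_iff vec.vector_space_axioms)

text \<open>Replaces the matrix by any complex-linear \<open>L\<close>, so that layers can be
  described by what they do to registers; the free neuron reads the single register
  \<open>r\<close>.\<close>

lemma register_closed_linear_step:
  fixes f :: "complex^'n::finite \<Rightarrow> complex^'r::finite"
  assumes C: "register_closed \<sigma> C" "f \<in> C" and L: "Vector_Spaces.linear (*s) (*s) L"
  shows "(\<lambda>z. L (f z) + \<sigma> (\<alpha> * f z $ r + \<beta>) *s c + d) \<in> C"
proof -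
  have "(\<Sum>j\<in>UNIV. matrix L $ s $ j * x $ j) = L x $ s" for s x
    using matrix_works[OF L, of x] by (simp add: matrix_vector_mult_def vec_eq_iff)
  moreover have "(\<Sum>j\<in>UNIV. (if j = r then \<alpha> else 0) * x $ j) = \<alpha> * x $ r" for x :: "complex^'r"
    by (simp add: if_distrib[of "\<lambda>x. x * _"] cong: if_cong)
  moreover have "(\<lambda>z. \<chi> s. (\<Sum>j\<in>UNIV. matrix L $ s $ j * f z $ j) +
      c $ s * \<sigma> ((\<Sum>j\<in>UNIV. (if j = r then \<alpha> else 0) * f z $ j) + \<beta>) + d $ s) \<in> C"
    by (rule C(1)[unfolded register_closed_def, THEN conjunct2, rule_format, OF C(2),
        of "\<lambda>s j. matrix L $ s $ j" c "\<lambda>j. if j = r then \<alpha> else 0" \<beta> d])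
  ultimately have "(\<lambda>z. \<chi> s. L (f z) $ s + c $ s * \<sigma> (\<alpha> * f z $ r + \<beta>) + d $ s) \<in> C"
    by simp
  moreover have "(\<chi> s. L (f z) $ s + c $ s * \<sigma> (\<alpha> * f z $ r + \<beta>) + d $ s) =
      L (f z) + \<sigma> (\<alpha> * f z $ r + \<beta>) *s c + d" for z
    by (simp add: vec_eq_iff mult.commute)
  ultimately show ?thesis by simp
qed

text \<open>The state of the computation: the input \<open>x\<close>, the output accumulator \<open>y\<close>, the argument
  \<open>t\<close> of the function being evaluated and the partial sum \<open>s\<close> of its value.\<close>

definition regs :: "complex^'n \<Rightarrow> complex^'m \<Rightarrow> complex \<Rightarrow> complex \<Rightarrow>
    complex^('n::finite + 'm::finite + bool)" where
  "regs x y t s = (\<chi> r. case r of Inl j \<Rightarrow> x $ j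
     | Inr q \<Rightarrow> (case q of Inl l \<Rightarrow> y $ l | Inr b \<Rightarrow> if b then t else s))"

lemma regs_nth [simp]:
  "regs x y t s $ Inl j = x $ j"
  "regs x y t s $ Inr (Inl l) = y $ l"
  "regs x y t s $ Inr (Inr b) = (if b then t else s)"
  by (simp_all add: regs_def)

lemma all_regs: "(\<forall>r. P r) \<longleftrightarrow> (\<forall>j. P (Inl j)) \<and> (\<forall>l. P (Inr (Inl l))) \<and> P (Inr (Inr True)) \<and> P (Inr (Inr False))"
  by (simp add: split_sum_all all_bool_eq)

lemma regs_eq_iff [simp]: "regs x y t s = regs x' y' t' s' \<longleftrightarrow> x = x' \<and> y = y' \<and> t = t' \<and> s = s'"
  by (auto simp: vec_eq_iff all_regs)

lemma regs_add [simp]: "regs x y t s + regs x' y' t' s' = regs (x + x') (y + y') (t + t') (s + s')"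
  by (simp add: vec_eq_iff all_regs)

lemma regs_diff [simp]: "regs x y t s - regs x' y' t' s' = regs (x - x') (y - y') (t - t') (s - s')"
  by (simp add: vec_eq_iff all_regs)

lemma regs_smult [simp]: "c *s regs x y t s = regs (c *s x) (c *s y) (c * t) (c * s)"
  by (simp add: vec_eq_iff all_regs)

lemma regs_collapse: "\<exists>x y t s. u = regs x y t s"
  by (rule exI[of _ "\<chi> j. u $ Inl j"], rule exI[of _ "\<chi> l. u $ Inr (Inl l)"],
      rule exI[of _ "u $ Inr (Inr True)"], rule exI[of _ "u $ Inr (Inr False)"])
     (simp add: vec_eq_iff all_regs)

lemma norm_regs_le: "norm (regs 0 y t 0 :: complex^('n::finite + 'm::finite + bool)) \<le> norm y + norm t"
proof -
  have "(\<Sum>r\<in>UNIV. (norm (regs 0 y t 0 $ (r :: 'n + 'm + bool)))\<^sup>2) = (norm y)\<^sup>2 + (norm t)\<^sup>2"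
    by (simp add: UNIV_bool norm_vec_def L2_set_def sum_nonneg sum.Plus o_def flip: UNIV_Plus_UNIV)
  then have "norm (regs 0 y t 0 :: complex^('n + 'm + bool)) = sqrt ((norm y)\<^sup>2 + (norm t)\<^sup>2)"
    by (simp add: norm_vec_def[of "regs 0 y t 0"] L2_set_def)
  then show ?thesis by (simp add: sqrt_sum_squares_le_sum)
qed

lemma continuous_on_regs:
  fixes x :: "'a::topological_space \<Rightarrow> complex^'n::finite" and y :: "'a \<Rightarrow> complex^'m::finite"
  assumes "continuous_on S x" "continuous_on S y" "continuous_on S t" "continuous_on S s"
  shows "continuous_on S (\<lambda>z. regs (x z) (y z) (t z) (s z))"
  unfolding regs_def
proof (rule continuous_on_vec_lambda)
  fix r :: "'n + 'm + bool"
  show "continuous_on S (\<lambda>z. case r of Inl j \<Rightarrow> x z $ j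
     | Inr q \<Rightarrow> (case q of Inl l \<Rightarrow> y z $ l | Inr b \<Rightarrow> if b then t z else s z))"
  proof (cases r)
    case (Inl j)
    then show ?thesis using assms by (auto intro!: continuous_intros)
  next
    case (Inr q)
    show ?thesis
    proof (cases q)
      case (Inl l)
      with \<open>r = Inr q\<close> assms show ?thesis by (auto intro!: continuous_intros)
    next
      case (Inr b)
      with \<open>r = Inr q\<close> assms show ?thesis by (cases b) auto
    qed
  qed
qed

text \<open>Pattern matching on the four register blocks, so that layer maps can be written as
  functions of \<open>x\<close>, \<open>y\<close>, \<open>t\<close> and \<open>s\<close>.\<close>

definition regs_map where
  "regs_map F u = (case (\<chi> j. u $ Inl j, \<chi> l. u $ Inr (Inl l), u $ Inr (Inr True), u $ Inr (Inr False)) of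
     (x, y, t, s) \<Rightarrow> F x y t s)"

lemma regs_map_regs [simp]: "regs_map F (regs x y t s) = F x y t s"
  by (simp add: regs_map_def)

locale register_machine = continuous_ridge \<sigma> for \<sigma> +
  fixes F :: "(complex^'n::finite \<Rightarrow> complex^('n + 'm::finite + bool)) set"
  assumes closed: "register_closed \<sigma> (compact_closure F)"
begin

text \<open>The input block always holds \<open>z\<close> itself, so that it can be read again for
  each term. Membership is in the closure: a computable state is exact, all approximation being
  hidden in \<open>compact_closure\<close>.\<close>

definition computable :: "(complex^'n \<Rightarrow> complex^'m) \<Rightarrow> (complex^'n \<Rightarrow> complex) \<Rightarrow> (complex^'n \<Rightarrow> complex) \<Rightarrow> bool" where
  "computable y t s \<longleftrightarrow> (\<lambda>z. regs z (y z) (t z) (s z)) \<in> compact_closure F"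

lemma computable_continuous:
  assumes "computable y t s"
  shows "continuous_on S y" "continuous_on S t" "continuous_on S s"
proof -
  let ?f = "\<lambda>z. regs z (y z) (t z) (s z)"
  have *: "continuous_on S ?f" using assms unfolding computable_def by (rule compact_closure_continuous)
  have "continuous_on S (\<lambda>z. \<chi> l. ?f z $ Inr (Inl l))" by (intro continuous_intros *)
  then show "continuous_on S y" by simp
  have "continuous_on S (\<lambda>z. ?f z $ Inr (Inr b))" for b by (intro continuous_intros *)
  from this[of True] this[of False] show "continuous_on S t" "continuous_on S s" by auto
qed

text \<open>The instructions that follow are instances. \<open>L\<close> must be complex-linear
  jointly in the four blocks, and the free neuron reads only the argument register.\<close>

lemma computable_step:
  assumes "computable y t s"
    and add: "\<And>x y t s x' y' t' s'. L (x + x') (y + y') (t + t') (s + s') = L x y t s + L x' y' t' s'"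
    and scale: "\<And>c x y t s. L (c *s x) (c *s y) (c * t) (c * s) = c *s L x y t s"
    and eq: "\<And>z. L z (y z) (t z) (s z) + \<sigma> (\<alpha> * t z + \<beta>) *s c + d = regs z (y' z) (t' z) (s' z)"
  shows "computable y' t' s'"
proof -
  have "Vector_Spaces.linear (*s) (*s) (regs_map L)"
  proof (rule linear_vecI)
    fix u v :: "complex^('n + 'm + bool)" and c
    obtain x y t s where u: "u = regs x y t s" using regs_collapse by blast
    obtain x' y' t' s' where v: "v = regs x' y' t' s'" using regs_collapse by blast
    show "regs_map L (u + v) = regs_map L u + regs_map L v" by (simp add: u v add)
    show "regs_map L (c *s u) = c *s regs_map L u" by (simp add: u scale)
  qed
  from register_closed_linear_step[OF closed assms(1)[unfolded computable_def] this,
      of \<alpha> "Inr (Inr True)" \<beta> c d]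
  show ?thesis by (simp add: eq computable_def)
qed

lemma computable_accumulate:
  assumes "computable y t s"
  shows "computable y t (\<lambda>z. s z + c * \<sigma> (\<alpha> * t z + \<beta>))"
  by (rule computable_step[OF assms, of regs \<alpha> \<beta> "regs 0 0 0 c" 0])
     (auto simp: mult.commute)

lemma computable_add_const:
  assumes "computable y t s"
  shows "computable y t (\<lambda>z. s z + c)"
  by (rule computable_step[OF assms, of regs 0 0 0 "regs 0 0 0 c"]) auto

text \<open>Ends an evaluation: the finished sum becomes the next argument, which makes compositions
  possible.\<close>

lemma computable_move:
  assumes "computable y t s"
  shows "computable y s (\<lambda>_. 0)"
  by (rule computable_step[OF assms, of "\<lambda>x y t s. regs x y s 0" 0 0 0 0]) auto

lemma computable_affine:
  assumes "computable y t s"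
  shows "computable y (\<lambda>z. a * t z + b) (\<lambda>_. 0)"
  by (rule computable_step[OF assms, of "\<lambda>x y t s. regs x y (a * t) 0" 0 0 0 "regs 0 0 b 0"])
     (auto simp: algebra_simps)

lemma computable_load:
  assumes "computable y t s"
  shows "computable y (\<lambda>z. \<Sum>j\<in>UNIV. a j * z $ j) (\<lambda>_. 0)"
  by (rule computable_step[OF assms, of "\<lambda>x y t s. regs x y (\<Sum>j\<in>UNIV. a j * x $ j) 0" 0 0 0 0])
     (auto simp: algebra_simps sum.distrib sum_distrib_left)

lemma computable_output:
  assumes "computable y t s"
  shows "computable (\<lambda>z. y z + t z *s v) t s"
  by (rule computable_step[OF assms, of "\<lambda>x y t s. regs x (y + t *s v) t s" 0 0 0 0])
     (auto simp: algebra_simps vec_eq_iff)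

text \<open>Each constructor of \<open>ridge_span\<close> acts on the partial sum, while the
  argument \<open>t\<close> stays in place to be used again. The induction needs arbitrary
  \<open>s\<close> for sums and arbitrary \<open>c\<close> for multiples.\<close>

lemma computable_ridge_span:
  assumes "g \<in> ridge_span \<sigma>" "computable y t s"
  shows "computable y t (\<lambda>z. s z + c * g (t z))"
  using assms
proof (induction arbitrary: s c rule: ridge_span.induct)
  case (const c')
  then show ?case by (rule computable_add_const)
next
  case (ridge a b)
  then show ?case by (rule computable_accumulate)
next
  case (add f g)
  from add.IH(2)[OF add.IH(1)[OF add.prems, of c], of c] show ?case
    by (simp add: algebra_simps)
next
  case (scale f c')
  from scale.IH[OF scale.prems, of "c * c'"] show ?case by (simp add: mult.assoc)
qed

lemma computable_limit:
  assumes "continuous_on UNIV y" "continuous_on UNIV t"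
    and lim: "\<And>K \<epsilon>. compact K \<Longrightarrow> \<epsilon> > 0 \<Longrightarrow>
      \<exists>y' t'. computable y' t' (\<lambda>_. 0) \<and> (\<forall>z\<in>K. norm (y' z - y z) < \<epsilon> \<and> norm (t' z - t z) < \<epsilon>)"
  shows "computable y t (\<lambda>_. 0)"
  unfolding computable_def
proof (rule compact_closure_limit)
  show "continuous_on UNIV (\<lambda>z. regs z (y z) (t z) 0)"
    by (intro continuous_on_regs continuous_intros assms)
  fix K :: "(complex^'n) set" and \<epsilon> :: real assume K: "compact K" "\<epsilon> > 0"
  then obtain y' t' where c: "computable y' t' (\<lambda>_. 0)"
    and near: "\<And>z. z \<in> K \<Longrightarrow> norm (y' z - y z) < \<epsilon> / 2 \<and> norm (t' z - t z) < \<epsilon> / 2"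
    using lim[of K "\<epsilon> / 2"] by auto
  have "norm (regs z (y' z) (t' z) 0 - regs z (y z) (t z) 0 :: complex^('n + 'm + bool)) < \<epsilon>" if "z \<in> K" for z
    using near[OF that] norm_regs_le[where ?'n = 'n, of "y' z - y z" "t' z - t z"] by simp
  then show "\<exists>g\<in>compact_closure F. \<forall>z\<in>K. norm (g z - regs z (y z) (t z) 0) < \<epsilon>"
    using c by (intro bexI[of _ "\<lambda>z. regs z (y' z) (t' z) 0"]) (auto simp: computable_def)
qed

text \<open>\<open>T\<close> restricts the arguments for which the approximation must hold. Since
  computable states are exact, \<open>t z\<close> lies in \<open>T\<close> itself and not merely
  near it; squaring uses this with \<open>T = \<real>\<close>.\<close>

lemma computable_apply:
  assumes c: "computable y t (\<lambda>_. 0)" and G: "continuous_on UNIV G"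
    and approx: "\<And>R \<epsilon>. \<epsilon> > 0 \<Longrightarrow> \<exists>g\<in>ridge_span \<sigma>. \<forall>w\<in>T. norm w \<le> R \<longrightarrow> norm (g w - G w) < \<epsilon>"
    and T: "\<And>z. t z \<in> T"
  shows "computable y (\<lambda>z. G (t z)) (\<lambda>_. 0)"
proof (rule computable_limit)
  note cont = computable_continuous[OF c]
  show "continuous_on UNIV y" by (rule cont)
  show "continuous_on UNIV (\<lambda>z. G (t z))" by (rule continuous_on_compose2[OF G cont(2)]) auto
  fix K :: "(complex^'n) set" and \<epsilon> :: real assume K: "compact K" "\<epsilon> > 0"
  have "compact (t ` K)" using cont(2) K(1) by (rule compact_continuous_image)
  then obtain R where R: "\<And>z. z \<in> K \<Longrightarrow> norm (t z) \<le> R"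
    by (metis compact_imp_bounded bounded_iff imageI)
  obtain g where g: "g \<in> ridge_span \<sigma>" "\<And>w. w \<in> T \<Longrightarrow> norm w \<le> R \<Longrightarrow> norm (g w - G w) < \<epsilon>"
    using approx[OF K(2)] by blast
  have "computable y (\<lambda>z. g (t z)) (\<lambda>_. 0)"
    using computable_move[OF computable_ridge_span[OF g(1) c, of 1]] by simp
  then show "\<exists>y' t'. computable y' t' (\<lambda>_. 0) \<and>
      (\<forall>z\<in>K. norm (y' z - y z) < \<epsilon> \<and> norm (t' z - G (t z)) < \<epsilon>)"
    using g(2) R T K(2) by (intro exI[of _ y] exI[of _ "\<lambda>z. g (t z)"]) auto
qed

lemma computable_Re:
  assumes "computable y t (\<lambda>_. 0)" and Re: "(\<lambda>w. of_real (Re w)) \<in> closed_span"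
  shows "computable y (\<lambda>z. of_real (Re (t z))) (\<lambda>_. 0)"
proof (rule computable_apply[OF assms(1), where T = UNIV])
  show "continuous_on UNIV (\<lambda>w. complex_of_real (Re w))" by (rule closed_span_continuous[OF Re])
  fix R \<epsilon> :: real assume "\<epsilon> > 0"
  from compact_closureE[OF Re[unfolded closed_span_def] compact_cball[of 0 R] this]
  show "\<exists>g\<in>ridge_span \<sigma>. \<forall>w\<in>UNIV. norm w \<le> R \<longrightarrow> norm (g w - of_real (Re w)) < \<epsilon>"
    by (metis mem_cball_0)
qed auto

lemma computable_real_power:
  assumes "\<not> R_affine \<sigma>" and "computable y (\<lambda>z. of_real (r z)) (\<lambda>_. 0)"
  shows "computable y (\<lambda>z. of_real (r z ^ 2 ^ k)) (\<lambda>_. 0)"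
proof (induction k)
  case 0
  then show ?case using assms(2) by simp
next
  case (Suc k)
  have "computable y (\<lambda>z. (of_real (r z ^ 2 ^ k))\<^sup>2) (\<lambda>_. 0)"
  proof (rule computable_apply[OF Suc, of "\<lambda>w. w\<^sup>2" \<real>])
    fix R \<epsilon> :: real assume "\<epsilon> > 0"
    from real_square_approx[OF assms(1) this, of R]
    obtain g where g: "g \<in> ridge_span \<sigma>"
      "\<And>x. \<bar>x\<bar> \<le> R \<Longrightarrow> norm (g (of_real x) - of_real (x\<^sup>2)) < \<epsilon>" by blast
    have "norm (g w - w\<^sup>2) < \<epsilon>" if w: "w \<in> \<real>" "norm w \<le> R" for w
    proof -
      obtain x where "w = of_real x" using w(1) by (rule Reals_cases)
      then show ?thesis using g(2)[of x] w(2) by simp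
    qed
    with g(1) show "\<exists>g\<in>ridge_span \<sigma>. \<forall>w\<in>\<real>. norm w \<le> R \<longrightarrow> norm (g w - w\<^sup>2) < \<epsilon>" by blast
  qed (auto intro: continuous_intros)
  then show ?case by (simp add: power_mult[symmetric] mult.commute flip: of_real_power)
qed

lemma computable_exp:
  assumes c: "computable y t (\<lambda>_. 0)" and Re: "(\<lambda>w. of_real (Re w)) \<in> closed_span"
    and na: "\<not> R_affine \<sigma>"
  shows "computable y (\<lambda>z. of_real (exp (Re (t z)))) (\<lambda>_. 0)"
proof (rule computable_limit)
  note cont = computable_continuous[OF c]
  show "continuous_on UNIV y" by (rule cont)
  show "continuous_on UNIV (\<lambda>z. complex_of_real (exp (Re (t z))))" by (intro continuous_intros cont)
  fix K :: "(complex^'n) set" and \<epsilon> :: real assume K: "compact K" "\<epsilon> > 0"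
  have "compact (t ` K)" using cont(2) K(1) by (rule compact_continuous_image)
  then obtain R where R: "\<And>z. z \<in> K \<Longrightarrow> norm (t z) \<le> R"
    by (metis compact_imp_bounded bounded_iff imageI)
  \<comment> \<open>\<open>M\<close> is the number of squarings: \<open>2 ^ M > M\<close> makes
    \<open>N\<close> exceed both \<open>R\<close> and the value required by the error bound.\<close>
  obtain M :: nat where M: "max R (exp R * R\<^sup>2 / \<epsilon>) < real M" using reals_Archimedean2 by blast
  define N :: nat where "N = 2 ^ M"
  have "real M < real N" unfolding N_def using of_nat_less_two_power[of M] by simp
  with M have N: "R \<le> real N" "exp R * R\<^sup>2 / \<epsilon> < real N" by auto
  have "N > 0" by (simp add: N_def)
  have "computable y (\<lambda>z. of_real (1 + Re (t z) / real N)) (\<lambda>_. 0)"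
    using computable_affine[OF computable_Re[OF c Re], of "1 / of_nat N" 1] by (simp add: add.commute)
  from computable_real_power[OF na this, of M]
  have "computable y (\<lambda>z. of_real ((1 + Re (t z) / real N) ^ N)) (\<lambda>_. 0)"
    by (simp only: N_def)
  moreover have "norm (complex_of_real ((1 + Re (t z) / real N) ^ N) - of_real (exp (Re (t z)))) < \<epsilon>"
    if "z \<in> K" for z
  proof -
    have "\<bar>Re (t z)\<bar> \<le> R" using R[OF that] abs_Re_le_cmod[of "t z"] by linarith
    then have "\<bar>(1 + Re (t z) / real N) ^ N - exp (Re (t z))\<bar> \<le> exp R * R\<^sup>2 / real N"
      using \<open>N > 0\<close> N(1) by (rule exp_power_approx)
    also have "\<dots> < \<epsilon>" using N(2) \<open>N > 0\<close> K(2) by (simp add: field_simps)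
    finally show ?thesis by (simp only: of_real_diff[symmetric] norm_of_real)
  qed
  ultimately show "\<exists>y' t'. computable y' t' (\<lambda>_. 0) \<and>
      (\<forall>z\<in>K. norm (y' z - y z) < \<epsilon> \<and> norm (t' z - of_real (exp (Re (t z)))) < \<epsilon>)"
    using K(2) by (intro exI[of _ y] exI[of _ "\<lambda>z. of_real ((1 + Re (t z) / real N) ^ N)"]) auto
qed

lemma computable_zero: "computable (\<lambda>_. 0) (\<lambda>_. 0) (\<lambda>_. 0)"
proof -
  define M :: "'n + 'm + bool \<Rightarrow> 'n \<Rightarrow> complex"
    where "M r j = (case r of Inl i \<Rightarrow> if i = j then 1 else 0 | Inr _ \<Rightarrow> 0)" for r j
  have "(\<lambda>z. \<chi> r. \<Sum>j\<in>UNIV. M r j * z $ j) \<in> compact_closure F"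
    using closed unfolding register_closed_def by blast
  moreover have "(\<chi> r. \<Sum>j\<in>UNIV. M r j * z $ j) = regs z 0 0 0" for z
    by (simp add: vec_eq_iff all_regs M_def if_distrib[of "\<lambda>x. x * _"] cong: if_cong)
  ultimately show ?thesis by (simp add: computable_def)
qed

end

section \<open>Density of real exponential sums\<close>

inductive_set exp_span :: "(complex^'n::finite \<Rightarrow> real) set" where
  zero: "(\<lambda>_. 0) \<in> exp_span"
| add: "f \<in> exp_span \<Longrightarrow> (\<lambda>z. f z + c * exp (Re (\<Sum>j\<in>UNIV. a j * z $ j))) \<in> exp_span"

lemma exp_span_exp: "(\<lambda>z. c * exp (Re (\<Sum>j\<in>UNIV. a j * z $ j))) \<in> exp_span"
  using exp_span.add[OF exp_span.zero, of c a] by simp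

lemma exp_span_plus:
  assumes "f \<in> exp_span" "g \<in> exp_span"
  shows "(\<lambda>z. f z + g z) \<in> exp_span"
  using assms(2)
proof induction
  case zero
  then show ?case using assms(1) by simp
next
  case (add g c a)
  from exp_span.add[OF add.IH, of c a] show ?case by (simp add: add.assoc)
qed

text \<open>Exponents add, which gives the closure under products that Stone-Weierstrass asks
  for.\<close>

lemma exp_span_mult_exp:
  assumes "f \<in> exp_span"
  shows "(\<lambda>z. f z * (c * exp (Re (\<Sum>j\<in>UNIV. a j * z $ j)))) \<in> exp_span"
  using assms
proof induction
  case zero
  then show ?case by (simp add: exp_span.zero)
next
  case (add f c' a')
  have "c' * exp (Re (\<Sum>j\<in>UNIV. a' j * z $ j)) * (c * exp (Re (\<Sum>j\<in>UNIV. a j * z $ j))) =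
      c' * c * exp (Re (\<Sum>j\<in>UNIV. (a' j + a j) * z $ j))" for z :: "complex^'a"
    by (simp add: distrib_right sum.distrib exp_add)
  with exp_span.add[OF add.IH, of "c' * c" "\<lambda>j. a' j + a j"] show ?case
    by (simp only: distrib_right)
qed

lemma exp_span_mult:
  assumes "f \<in> exp_span" "g \<in> exp_span"
  shows "(\<lambda>z. f z * g z) \<in> exp_span"
  using assms(2)
proof induction
  case zero
  then show ?case by (simp add: exp_span.zero)
next
  case (add g c a)
  from exp_span_plus[OF add.IH exp_span_mult_exp[OF assms(1), of c a]] show ?case
    by (simp only: distrib_left)
qed

lemma exp_span_continuous: "f \<in> exp_span \<Longrightarrow> continuous_on S f"
  by (induction rule: exp_span.induct) (auto intro!: continuous_intros)

lemma exp_span_separates: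
  fixes x y :: "complex^'n::finite"
  assumes "x \<noteq> y"
  shows "\<exists>f\<in>exp_span. f x \<noteq> f y"
proof -
  obtain i where i: "x $ i \<noteq> y $ i" using assms by (auto simp: vec_eq_iff)
  have coord: "(\<Sum>j\<in>UNIV. (if j = i then b else 0) * z $ j) = b * z $ i" for z :: "complex^'n" and b
    by (simp add: if_distrib[of "\<lambda>x. x * _"] cong: if_cong)
  have mem: "(\<lambda>z::complex^'n. exp (Re (b * z $ i))) \<in> exp_span" for b
    using exp_span_exp[of 1 "\<lambda>j. if j = i then b else 0"] by (simp only: coord mult_1)
  \<comment> \<open>\<open>b = 1\<close> detects a difference of real parts,
    \<open>b = - \<i>\<close> one of imaginary parts.\<close>
  from i have "Re (1 * x $ i) \<noteq> Re (1 * y $ i) \<or> Re (- \<i> * x $ i) \<noteq> Re (- \<i> * y $ i)"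
    by (auto simp: complex_eq_iff)
  then obtain b where "Re (b * x $ i) \<noteq> Re (b * y $ i)" by blast
  then show ?thesis using mem[of b] by (intro bexI[OF _ mem[of b]]) simp
qed

lemma exp_span_dense:
  fixes f :: "complex^'n::finite \<Rightarrow> real"
  assumes "compact K" "continuous_on K f" "\<epsilon> > 0"
  shows "\<exists>g\<in>exp_span. \<forall>x\<in>K. \<bar>f x - g x\<bar> < \<epsilon>"
proof -
  interpret function_ring_on "exp_span :: (complex^'n \<Rightarrow> real) set" K
  proof
    show "(\<lambda>_. c) \<in> exp_span" for c :: real
      using exp_span_exp[of c "\<lambda>_. 0"] by simp
  qed (auto intro: assms exp_span_continuous exp_span_plus exp_span_mult exp_span_separates)
  show ?thesis by (rule Stone_Weierstrass_basic[OF assms(2,3)])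
qed

section \<open>Assembling the target in the output registers\<close>

context register_machine
begin

definition output_computable :: "(complex^'n \<Rightarrow> complex^'m) \<Rightarrow> bool" where
  "output_computable y \<longleftrightarrow> computable y (\<lambda>_. 0) (\<lambda>_. 0)"

context
  assumes not_hol: "\<not> \<sigma> holomorphic_on UNIV" and not_antihol: "\<not> antiholomorphic \<sigma>"
    and not_affine: "\<not> R_affine \<sigma>"
begin

lemma output_computable_add_exp:
  assumes "output_computable y"
  shows "output_computable (\<lambda>z. y z + of_real (exp (Re (\<Sum>j\<in>UNIV. a j * z $ j))) *s v)"
proof -
  from computable_load[OF assms[unfolded output_computable_def], of a]
  have "computable y (\<lambda>z. of_real (exp (Re (\<Sum>j\<in>UNIV. a j * z $ j)))) (\<lambda>_. 0)"
    by (rule computable_exp[OF _ Re_in_closed_span[OF not_hol not_antihol] not_affine])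
  \<comment> \<open>Loading the zero functional clears the argument register for the next
    term.\<close>
  from computable_load[OF computable_output[OF this, of v], of "\<lambda>_. 0"]
  show ?thesis by (simp add: output_computable_def)
qed

lemma output_computable_add_exp_span:
  assumes "f \<in> exp_span" "output_computable y"
  shows "output_computable (\<lambda>z. y z + of_real (f z) *s v)"
  using assms
proof induction
  case (add f c a)
  from output_computable_add_exp[OF add.IH[OF add.prems], of a "of_real c *s v"]
  show ?case by (simp add: algebra_simps vec.scale_left_distrib)
qed simp

lemma output_computable_add_real:
  assumes f: "continuous_on UNIV f" and y: "output_computable y"
  shows "output_computable (\<lambda>z. y z + of_real (f z) *s v)"
  unfolding output_computable_def
proof (rule computable_limit)
  have cont_smult: "continuous_on S (\<lambda>z. g z *s v)" if "continuous_on S g" for S :: "(complex^'n) set" and g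
    unfolding vector_scalar_mult_def by (intro continuous_intros that)
  show "continuous_on UNIV (\<lambda>z. y z + of_real (f z) *s v)"
    using y[unfolded output_computable_def]
    by (intro continuous_on_add cont_smult continuous_intros f computable_continuous(1))
  fix K :: "(complex^'n) set" and \<epsilon> :: real assume K: "compact K" "\<epsilon> > 0"
  have "\<epsilon> / (norm v + 1) > 0" using K(2) by (simp add: add_nonneg_pos)
  from exp_span_dense[OF K(1) continuous_on_subset[OF f] this]
  obtain g where g: "g \<in> exp_span" "\<And>z. z \<in> K \<Longrightarrow> \<bar>f z - g z\<bar> < \<epsilon> / (norm v + 1)" by auto
  have "norm ((y z + of_real (g z) *s v) - (y z + of_real (f z) *s v)) < \<epsilon>" if "z \<in> K" for z
  proof -
    have "(y z + of_real (g z) *s v) - (y z + of_real (f z) *s v) = (g z - f z) *\<^sub>R v"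
      by (simp add: vec_eq_iff) (simp add: scaleR_conv_of_real algebra_simps)
    then have "norm ((y z + of_real (g z) *s v) - (y z + of_real (f z) *s v)) = \<bar>f z - g z\<bar> * norm v"
      by (simp add: abs_minus_commute)
    also have "\<dots> \<le> \<bar>f z - g z\<bar> * (norm v + 1)" by (intro mult_left_mono) auto
    also have "\<dots> < \<epsilon>" using g(2)[OF that] by (simp add: pos_less_divide_eq add_nonneg_pos)
    finally show ?thesis .
  qed
  then show "\<exists>y' t'. computable y' t' (\<lambda>_. 0) \<and>
      (\<forall>z\<in>K. norm (y' z - (y z + of_real (f z) *s v)) < \<epsilon> \<and> norm (t' z - 0) < \<epsilon>)"
    using output_computable_add_exp_span[OF g(1) y, of v] K(2) unfolding output_computable_def
    by (intro exI[of _ "\<lambda>z. y z + of_real (g z) *s v"] exI[of _ "\<lambda>_. 0"]) simp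
qed simp

text \<open>Exponential sums are real-valued, so the target is added one real function at a time:
  the real and the imaginary part of each coordinate, along \<open>axis l 1\<close> and
  \<open>axis l \<i>\<close>.\<close>

lemma output_computable_continuous:
  assumes g: "continuous_on UNIV g"
  shows "output_computable g"
proof -
  have part: "output_computable (\<lambda>z. \<Sum>l\<in>I. of_real (Re (g z $ l)) *s axis l 1 + of_real (Im (g z $ l)) *s axis l \<i>)"
    if "finite I" for I
    using that
  proof (induction I)
    case empty
    then show ?case using computable_zero by (simp add: output_computable_def)
  next
    case (insert l I)
    have "continuous_on UNIV (\<lambda>z. Re (g z $ l))" "continuous_on UNIV (\<lambda>z. Im (g z $ l))"
      by (intro continuous_intros g)+
    from output_computable_add_real[OF this(2)
        output_computable_add_real[OF this(1) insert.IH, of "axis l 1"], of "axis l \<i>"]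
    show ?case using insert.hyps by (simp add: add_ac)
  qed
  moreover have "(\<Sum>l\<in>UNIV. of_real (Re (u $ l)) *s axis l 1 + of_real (Im (u $ l)) *s axis l \<i>) = u"
    for u :: "complex^'m"
  proof -
    have "(\<Sum>l\<in>UNIV. of_real (Re (u $ l)) *s axis l 1 + of_real (Im (u $ l)) *s axis l \<i>) $ i =
        (\<Sum>l\<in>UNIV. if l = i then u $ l else 0)" for i
      unfolding sum_component by (rule sum.cong) (auto simp: axis_def complex_eq_iff)
    then show ?thesis by (simp add: vec_eq_iff)
  qed
  ultimately show ?thesis using part[of UNIV] by simp
qed

end

end

text \<open>Dropping the other registers only deletes rows of the output layer, and it does not
  increase the norm of the error.\<close>

lemma NN_output_projection:
  fixes g :: "complex^'n::finite \<Rightarrow> complex^'m::finite"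
  assumes g: "continuous_on UNIV g"
    and mem: "(\<lambda>z. regs z (g z) 0 0) \<in> compact_closure (NN \<rho> W)"
  shows "g \<in> compact_closure (NN \<rho> W)"
proof (rule compact_closureI[OF g])
  fix K :: "(complex^'n) set" and \<epsilon> :: real assume "compact K" "\<epsilon> > 0"
  from compact_closureE[OF mem this]
  obtain f where f: "f \<in> NN \<rho> W" "\<And>z. z \<in> K \<Longrightarrow> norm (f z - regs z (g z) 0 0) < \<epsilon>" by blast
  obtain A b h where h: "f = output_layer W A b \<circ> h" "h \<in> hidden_part \<rho> W"
    using f(1) by (auto simp: NN_def)
  define P where "P u = (\<chi> l. u $ Inr (Inl l))" for u :: "complex^('n + 'm + bool)"
  have "P \<circ> f = output_layer W (\<lambda>l. A (Inr (Inl l))) (P b) \<circ> h"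
    by (simp add: h(1) P_def fun_eq_iff output_layer_def)
  then have "P \<circ> f \<in> NN \<rho> W" using h(2) unfolding NN_def by blast
  moreover have "norm ((P \<circ> f) z - g z) < \<epsilon>" if "z \<in> K" for z
  proof -
    define u where "u = f z - regs z (g z) 0 0"
    have "norm (P u) \<le> norm u"
    proof -
      have "(\<Sum>l\<in>UNIV. (norm (u $ Inr (Inl l)))\<^sup>2) = (\<Sum>r\<in>range (Inr \<circ> Inl). (norm (u $ r))\<^sup>2)"
        by (subst sum.reindex) (auto intro: inj_compose)
      also have "\<dots> \<le> (\<Sum>r\<in>UNIV. (norm (u $ r))\<^sup>2)" by (rule sum_mono2) auto
      finally show ?thesis by (simp add: norm_vec_def L2_set_def P_def)
    qed
    moreover have "P u = (P \<circ> f) z - g z" by (simp add: u_def P_def vec_eq_iff)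
    ultimately show ?thesis using f(2)[OF that] by (simp add: u_def)
  qed
  ultimately show "\<exists>f\<in>NN \<rho> W. \<forall>z\<in>K. norm (f z - g z) < \<epsilon>" by blast
qed

lemma universal_NN_if_register_closed:
  assumes \<sigma>: "continuous_on UNIV \<sigma>" "\<not> \<sigma> holomorphic_on UNIV" "\<not> antiholomorphic \<sigma>" "\<not> R_affine \<sigma>"
    and closed: "register_closed \<sigma> (compact_closure (NN \<rho> W) ::
      (complex^'n::finite \<Rightarrow> complex^('n + 'm::finite + bool)) set)"
  shows "universal (NN \<rho> W :: (complex^'n \<Rightarrow> complex^'m) set)"
proof -
  interpret register_machine \<sigma> "NN \<rho> W :: (complex^'n \<Rightarrow> complex^('n + 'm + bool)) set"
    by unfold_locales (fact \<sigma>(1), fact closed)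
  show ?thesis
    unfolding universal_iff_compact_closure
  proof (intro allI impI)
    fix g :: "complex^'n \<Rightarrow> complex^'m" assume g: "continuous_on UNIV g"
    from output_computable_continuous[OF \<sigma>(2-4) g]
    show "g \<in> compact_closure (NN \<rho> W)"
      by (intro NN_output_projection[OF g]) (simp add: output_computable_def computable_def)
  qed
qed

lemma R_affine_compose_cnj:
  assumes "R_affine (\<lambda>w. \<rho> (cnj w))"
  shows "R_affine \<rho>"
proof -
  obtain L c where L: "linear L" "\<And>w. \<rho> (cnj w) = L w + c" using assms by (auto simp: R_affine_def)
  have "linear (L \<circ> cnj)" by (intro linear_compose L bounded_linear.linear bounded_linear_cnj)
  moreover have "\<rho> w = (L \<circ> cnj) w + c" for w using L(2)[of "cnj w"] by simp
  ultimately show ?thesis unfolding R_affine_def by blast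
qed

text \<open>\<open>cnj \<circ> (\<rho> \<circ> cnj) \<circ> cnj\<close> is
  \<open>cnj \<circ> \<rho>\<close>: passing to \<open>\<rho> \<circ> cnj\<close> exchanges the
  holomorphic and the antiholomorphic case.\<close>

lemma holomorphic_compose_cnj:
  assumes "(\<lambda>w. \<rho> (cnj w)) holomorphic_on UNIV"
  shows "antiholomorphic \<rho>"
  using holomorphic_on_compose_cnj_cnj[of "\<lambda>w. \<rho> (cnj w)" UNIV] assms
  by (simp add: o_def antiholomorphic_def holomorphic_on_subset)

lemma antiholomorphic_compose_cnj:
  assumes "antiholomorphic (\<lambda>w. \<rho> (cnj w))"
  shows "\<rho> holomorphic_on UNIV"
  using holomorphic_on_compose_cnj_cnj[of "\<lambda>w. cnj (\<rho> (cnj w))" UNIV] assms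
  by (simp add: o_def antiholomorphic_def holomorphic_on_subset)

theorem theorem1p1:
  fixes \<rho> :: "complex \<Rightarrow> complex" and z0 px py :: complex
  assumes "continuous_on UNIV \<rho>"
    and "real_diff_at \<rho> z0 px py"
    and "(px, py) \<noteq> (0, 0)"
  shows "universal (NN \<rho> (2 * CARD('n::finite) + 2 * CARD('m::finite) + 5)
            :: (complex^'n \<Rightarrow> complex^'m) set)
         \<longleftrightarrow> \<not> (\<rho> holomorphic_on UNIV) \<and> \<not> antiholomorphic \<rho> \<and> \<not> R_affine \<rho>"
proof
  let ?W = "2 * CARD('n) + 2 * CARD('m) + 5"
  show "\<not> (\<rho> holomorphic_on UNIV) \<and> \<not> antiholomorphic \<rho> \<and> \<not> R_affine \<rho>"
    if "universal (NN \<rho> ?W :: (complex^'n \<Rightarrow> complex^'m) set)"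
    using that not_universal_NN by blast
  assume \<rho>: "\<not> (\<rho> holomorphic_on UNIV) \<and> \<not> antiholomorphic \<rho> \<and> \<not> R_affine \<rho>"
  \<comment> \<open>\<open>'n + 'm + bool\<close> has n + m + 2 elements, so the second bound holds
    with equality.\<close>
  have W: "2 * CARD('n) + 1 \<le> ?W" "2 * CARD('n + 'm + bool) + 1 \<le> ?W" by simp_all
  from two_neuron_approx_id_or_cnj[OF assms(2,3)]
  show "universal (NN \<rho> ?W :: (complex^'n \<Rightarrow> complex^'m) set)"
  proof
    assume "two_neuron_approx \<rho> (\<lambda>w. w)"
    from universal_NN_if_register_closed[OF assms(1) _ _ _ NN_register_closed_id[OF this assms(1) W]]
    show ?thesis using \<rho> by blast
  next
    assume "two_neuron_approx \<rho> cnj"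
    note closed = NN_register_closed_cnj[OF this assms(1) W]
    have "continuous_on UNIV (\<lambda>w. \<rho> (cnj w))"
      by (rule continuous_on_compose2[OF assms(1)]) (auto intro: linear_continuous_on bounded_linear_cnj)
    from universal_NN_if_register_closed[OF this _ _ _ closed]
    show ?thesis
      using \<rho> holomorphic_compose_cnj antiholomorphic_compose_cnj R_affine_compose_cnj by blast
  qed
qed

end
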